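(* Let $S$ be a countable inverse semigroup with universal groupoid $\mathscr G(S)$. The categories of $\mathscr G(S)$-spaces and of special $S$-spaces are isomorphic. More precisely, each special $S$-space $X$ has the structure of a $\mathscr G(S)$-space and vice versa (the isomorphism leaves underlying spaces and maps unchanged). Moreover, for $X$ a special $S$-space with its corresponding $\mathscr G(S)$-space structure, the groupoid of germs $S\ltimes X$ of the action of $S$ on $X$ is topologically isomorphic to the semidirect product $\mathscr G(S)\ltimes X$.
   Context: An inverse semigroup is a semigroup $S$ in which each $s$ has a unique $s^*$ with $s=ss^*s$, $s^*=s^*ss^*$; $E=E(S)$ is its semilattice of idempotents; $s\le t$ iff $s=te$ for some $e\in E$. An $S$-space is a pair $(X,\theta)$ with $X$ a topological space and $\theta$ a homomorphism from $S$ to the inverse monoid $I_X$ of homeomorphisms between open subsets of $X$, such that $X=\bigcup_{e\in E}X_e$, where $X_e$ is the domain of $\theta(e)$; write $sx=\theta(s)(x)$ for $x\in X_{s^*s}$. A morphism $f\colon X\to Y$ of $S$-spaces is a continuous map with $f^{-1}(Y_e)=X_e$ for all $e\in E$ and $f(sx)=sf(x)$ for $x\in X_{s^*s}$. $X$ is special if $X_e$ is clopen for all $e\in E$. The groupoid of germs $S\ltimes X$ consists of classes $[s,x]$ with $x\in X_{s^*s}$, where $(s,x)\sim(t,y)$ iff $x=y$ and there is $u\le s,t$ with $x\in X_{u^*u}$; $d[s,x]=x$, $r[s,x]=sx$, $[s,ty][t,y]=[st,y]$, $[s,x]^{-1}=[s^*,sx]$; basis of the topology: $(s,U)=\{[s,x]\mid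 x\in U\}$, $U\subseteq X_{s^*s}$ open. The universal groupoid $\mathscr G(S)$ is the groupoid of germs of the action of $S$ on the space $\widehat E$ of all non-zero semilattice homomorphisms $E\to\{0,1\}$ (subspace of $\{0,1\}^E$) given by $s\varphi\in D(ss^* )$, $(s\varphi)(e)=\varphi(s^*es)$ for $\varphi\in D(s^*s)$, where $D(e)=\{\varphi\mid\varphi(e)=1\}$. Its unit space is identified with $\widehat E$. For a topological groupoid $\mathscr G$ with unit space $\mathscr G_0$, a $\mathscr G$-space is a space $X$ with continuous maps $p\colon X\to\mathscr G_0$ and $\mathscr G\times_{\mathscr G_0}X=\{(g,x)\mid d(g)=p(x)\}\to X$, $(g,x)\mapsto gx$, such that $p(x)x=x$, $p(gx)=r(g)$ and $g(hx)=(gh)x$ when defined. Morphisms $f\colon X\to Y$ of $\mathscr G$-spaces are continuous maps with $p_Yf=p_X$ and $f(gx)=gf(x)$. The semidirect product $\mathscr G\ltimes X$ is the topological groupoid on the space $\mathscr G\times_{\mathscr G_0}X$ with $d(g,x)=x$, $r(g,x)=gx$, $(g,hy)(h,y)=(gh,y)$, $(g,x)^{-1}=(g^{-1},gx)$, units identified with $X$ via $x\mapsto(p(x),x)$. *)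

theory Defs
  imports "HOL-Analysis.Analysis"
begin

class inverse_semigroup = semigroup_mult +
  assumes ex1_star: "\<exists>!t. s = s * t * s \<and> t = t * s * t"

definition star :: "'s::inverse_semigroup \<Rightarrow> 's" where
  "star s = (THE t. s = s * t * s \<and> t = t * s * t)"

definition idempotents :: "'s::inverse_semigroup set" where
  "idempotents = {e. e * e = e}"

definition natural_le :: "'s::inverse_semigroup \<Rightarrow> 's \<Rightarrow> bool" where
  "natural_le s t \<longleftrightarrow> (\<exists>e\<in>idempotents. s = t * e)"

text \<open>The inverse monoid \<open>I\<^sub>X\<close>; partial maps are composed with \<^const>\<open>map_comp\<close>.\<close>

definition partial_homeos :: "'x topology \<Rightarrow> ('x \<rightharpoonup> 'x) set" where
  "partial_homeos X =
     {h. openin X (dom h) \<and> openin X (ran h) \<and>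
         homeomorphic_map (subtopology X (dom h)) (subtopology X (ran h)) (\<lambda>x. the (h x))}"

record ('s, 'x) sspace =
  sp_top :: "'x topology"
  sp_act :: "'s \<Rightarrow> ('x \<rightharpoonup> 'x)"

definition sp_dom :: "('s, 'x) sspace \<Rightarrow> 's \<Rightarrow> 'x set" where
  "sp_dom X e = dom (sp_act X e)"

definition sp_app :: "('s, 'x) sspace \<Rightarrow> 's \<Rightarrow> 'x \<Rightarrow> 'x" where
  "sp_app X s x = the (sp_act X s x)"

definition is_sspace :: "('s::inverse_semigroup, 'x) sspace \<Rightarrow> bool" where
  "is_sspace X \<longleftrightarrow>
     (\<forall>s. sp_act X s \<in> partial_homeos (sp_top X)) \<and>
     (\<forall>s t. sp_act X (s * t) = sp_act X s \<circ>\<^sub>m sp_act X t) \<and>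
     topspace (sp_top X) = (\<Union>e\<in>idempotents. sp_dom X e)"

definition special_sspace :: "('s::inverse_semigroup, 'x) sspace \<Rightarrow> bool" where
  "special_sspace X \<longleftrightarrow>
     is_sspace X \<and>
     (\<forall>e\<in>idempotents. openin (sp_top X) (sp_dom X e) \<and> closedin (sp_top X) (sp_dom X e))"

text \<open>Maps out of a space are normalised to be \<^const>\<open>undefined\<close> outside its carrier, so that
  equality of morphisms is equality of functions.\<close>

definition sspace_hom ::
  "('s::inverse_semigroup, 'x) sspace \<Rightarrow> ('s, 'y) sspace \<Rightarrow> ('x \<Rightarrow> 'y) set" where
  "sspace_hom X Y =
     {f. f \<in> extensional (topspace (sp_top X)) \<and>
         continuous_map (sp_top X) (sp_top Y) f \<and>
         (\<forall>e\<in>idempotents. {x \<in> topspace (sp_top X). f x \<in> sp_dom Y e} = sp_dom X e) \<and>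
         (\<forall>s. \<forall>x\<in>sp_dom X (star s * s). f (sp_app X s x) = sp_app Y s (f x))}"

text \<open>The unit space is kept as a separate space \<open>gpd_units\<close>, embedded into the space of arrows by
  \<open>gpd_unit\<close>; this makes the usual identifications of unit spaces explicit. The product
  \<open>gpd_mult G g h\<close> is only meaningful if \<open>gpd_dom G g = gpd_ran G h\<close>.\<close>

record ('g, 'b) groupoid =
  gpd_arrows :: "'g topology"
  gpd_units :: "'b topology"
  gpd_dom :: "'g \<Rightarrow> 'b"
  gpd_ran :: "'g \<Rightarrow> 'b"
  gpd_unit :: "'b \<Rightarrow> 'g"
  gpd_mult :: "'g \<Rightarrow> 'g \<Rightarrow> 'g"
  gpd_inv :: "'g \<Rightarrow> 'g"

definition topological_groupoid_iso ::
  "('g, 'b) groupoid \<Rightarrow> ('h, 'c) groupoid \<Rightarrow> ('g \<Rightarrow> 'h) \<Rightarrow> ('b \<Rightarrow> 'c) \<Rightarrow> bool" where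
  "topological_groupoid_iso G H \<Phi> \<Phi>0 \<longleftrightarrow>
     homeomorphic_map (gpd_arrows G) (gpd_arrows H) \<Phi> \<and>
     homeomorphic_map (gpd_units G) (gpd_units H) \<Phi>0 \<and>
     (\<forall>x\<in>topspace (gpd_units G). \<Phi> (gpd_unit G x) = gpd_unit H (\<Phi>0 x)) \<and>
     (\<forall>g\<in>topspace (gpd_arrows G).
        gpd_dom H (\<Phi> g) = \<Phi>0 (gpd_dom G g) \<and>
        gpd_ran H (\<Phi> g) = \<Phi>0 (gpd_ran G g) \<and>
        \<Phi> (gpd_inv G g) = gpd_inv H (\<Phi> g)) \<and>
     (\<forall>g\<in>topspace (gpd_arrows G). \<forall>h\<in>topspace (gpd_arrows G).
        gpd_dom G g = gpd_ran G h \<longrightarrow> \<Phi> (gpd_mult G g h) = gpd_mult H (\<Phi> g) (\<Phi> h))"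

definition topologically_isomorphic :: "('g, 'b) groupoid \<Rightarrow> ('h, 'c) groupoid \<Rightarrow> bool" where
  "topologically_isomorphic G H \<longleftrightarrow> (\<exists>\<Phi> \<Phi>0. topological_groupoid_iso G H \<Phi> \<Phi>0)"

definition germ_rel :: "('s::inverse_semigroup, 'x) sspace \<Rightarrow> (('s \<times> 'x) \<times> ('s \<times> 'x)) set" where
  "germ_rel X =
     {((s, x), (t, y)). x \<in> sp_dom X (star s * s) \<and> y \<in> sp_dom X (star t * t) \<and> x = y \<and>
        (\<exists>u. natural_le u s \<and> natural_le u t \<and> x \<in> sp_dom X (star u * u))}"

definition germ :: "('s::inverse_semigroup, 'x) sspace \<Rightarrow> 's \<Rightarrow> 'x \<Rightarrow> ('s \<times> 'x) set" where
  "germ X s x = germ_rel X `` {(s, x)}"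

text \<open>Operations on germs are lifted from representatives by taking unions over all
  representatives, as in \<^theory>\<open>HOL.Equiv_Relations\<close>; the unit at \<open>x\<close> is the class
  \<open>[e, x]\<close> for any idempotent \<open>e\<close> with \<open>x \<in> X\<^sub>e\<close>.\<close>

definition germ_groupoid ::
  "('s::inverse_semigroup, 'x) sspace \<Rightarrow> (('s \<times> 'x) set, 'x) groupoid" where
  "germ_groupoid X =
     \<lparr>gpd_arrows = topology_generated_by
        {germ X s ` U | s U. openin (sp_top X) U \<and> U \<subseteq> sp_dom X (star s * s)},
      gpd_units = sp_top X,
      gpd_dom = (\<lambda>g. the_elem ((\<lambda>(s, x). x) ` g)),
      gpd_ran = (\<lambda>g. the_elem ((\<lambda>(s, x). sp_app X s x) ` g)),
      gpd_unit = (\<lambda>x. \<Union>e\<in>{e \<in> idempotents. x \<in> sp_dom X e}. germ X e x),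
      gpd_mult = (\<lambda>g h. \<Union>(s, x)\<in>g. \<Union>(t, y)\<in>h. germ X (s * t) y),
      gpd_inv = (\<lambda>g. \<Union>(s, x)\<in>g. germ X (star s) (sp_app X s x))\<rparr>"

text \<open>The two-element semilattice \<open>{0, 1}\<close> is \<^typ>\<open>bool\<close> with conjunction. Characters are, as
  points of the product space, \<^const>\<open>undefined\<close> outside the idempotents.\<close>

definition characters :: "('s::inverse_semigroup \<Rightarrow> bool) set" where
  "characters =
     {\<phi> \<in> extensional idempotents.
        (\<forall>e\<in>idempotents. \<forall>f\<in>idempotents. \<phi> (e * f) \<longleftrightarrow> \<phi> e \<and> \<phi> f) \<and> (\<exists>e\<in>idempotents. \<phi> e)}"

definition character_topology :: "('s::inverse_semigroup \<Rightarrow> bool) topology" where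
  "character_topology =
     subtopology (product_topology (\<lambda>_. discrete_topology UNIV) idempotents) characters"

definition basic_D :: "'s::inverse_semigroup \<Rightarrow> ('s \<Rightarrow> bool) set" where
  "basic_D e = {\<phi> \<in> characters. \<phi> e}"

definition character_sspace :: "('s::inverse_semigroup, 's \<Rightarrow> bool) sspace" where
  "character_sspace =
     \<lparr>sp_top = character_topology,
      sp_act = (\<lambda>s \<phi>. if \<phi> \<in> basic_D (star s * s)
                      then Some (restrict (\<lambda>e. \<phi> (star s * e * s)) idempotents) else None)\<rparr>"

definition universal_groupoid ::
  "(('s::inverse_semigroup \<times> ('s \<Rightarrow> bool)) set, 's \<Rightarrow> bool) groupoid" where
  "universal_groupoid = germ_groupoid character_sspace"

record ('g, 'b, 'x) gspace =
  gsp_top :: "'x topology"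
  gsp_anchor :: "'x \<Rightarrow> 'b"
  gsp_act :: "'g \<times> 'x \<Rightarrow> 'x"

definition fibre_product :: "('g, 'b) groupoid \<Rightarrow> ('g, 'b, 'x) gspace \<Rightarrow> ('g \<times> 'x) set" where
  "fibre_product G X =
     {(g, x). g \<in> topspace (gpd_arrows G) \<and> x \<in> topspace (gsp_top X) \<and>
        gpd_dom G g = gsp_anchor X x}"

definition fibre_product_topology ::
  "('g, 'b) groupoid \<Rightarrow> ('g, 'b, 'x) gspace \<Rightarrow> ('g \<times> 'x) topology" where
  "fibre_product_topology G X =
     subtopology (prod_topology (gpd_arrows G) (gsp_top X)) (fibre_product G X)"

definition is_gspace :: "('g, 'b) groupoid \<Rightarrow> ('g, 'b, 'x) gspace \<Rightarrow> bool" where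
  "is_gspace G X \<longleftrightarrow>
     gsp_anchor X \<in> extensional (topspace (gsp_top X)) \<and>
     gsp_act X \<in> extensional (fibre_product G X) \<and>
     continuous_map (gsp_top X) (gpd_units G) (gsp_anchor X) \<and>
     continuous_map (fibre_product_topology G X) (gsp_top X) (gsp_act X) \<and>
     (\<forall>x\<in>topspace (gsp_top X). gsp_act X (gpd_unit G (gsp_anchor X x), x) = x) \<and>
     (\<forall>(g, x)\<in>fibre_product G X. gsp_anchor X (gsp_act X (g, x)) = gpd_ran G g) \<and>
     (\<forall>g\<in>topspace (gpd_arrows G). \<forall>(h, x)\<in>fibre_product G X.
        gpd_dom G g = gpd_ran G h \<longrightarrow>
        gsp_act X (g, gsp_act X (h, x)) = gsp_act X (gpd_mult G g h, x))"

definition gspace_hom ::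
  "('g, 'b) groupoid \<Rightarrow> ('g, 'b, 'x) gspace \<Rightarrow> ('g, 'b, 'y) gspace \<Rightarrow> ('x \<Rightarrow> 'y) set" where
  "gspace_hom G X Y =
     {f. f \<in> extensional (topspace (gsp_top X)) \<and>
         continuous_map (gsp_top X) (gsp_top Y) f \<and>
         (\<forall>x\<in>topspace (gsp_top X). gsp_anchor Y (f x) = gsp_anchor X x) \<and>
         (\<forall>(g, x)\<in>fibre_product G X. f (gsp_act X (g, x)) = gsp_act Y (g, f x))}"

definition semidirect_product ::
  "('g, 'b) groupoid \<Rightarrow> ('g, 'b, 'x) gspace \<Rightarrow> ('g \<times> 'x, 'x) groupoid" where
  "semidirect_product G X =
     \<lparr>gpd_arrows = fibre_product_topology G X,
      gpd_units = gsp_top X,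
      gpd_dom = (\<lambda>(g, x). x),
      gpd_ran = (\<lambda>(g, x). gsp_act X (g, x)),
      gpd_unit = (\<lambda>x. (gpd_unit G (gsp_anchor X x), x)),
      gpd_mult = (\<lambda>(g, z) (h, y). (gpd_mult G g h, y)),
      gpd_inv = (\<lambda>(g, x). (gpd_inv G g, gsp_act X (g, x)))\<rparr>"

text \<open>Composition is indexed by source, middle and target object, because an extensional function
  does not determine these.\<close>

record ('o, 'm) category =
  cat_ob :: "'o set"
  cat_hom :: "'o \<Rightarrow> 'o \<Rightarrow> 'm set"
  cat_id :: "'o \<Rightarrow> 'm"
  cat_comp :: "'o \<Rightarrow> 'o \<Rightarrow> 'o \<Rightarrow> 'm \<Rightarrow> 'm \<Rightarrow> 'm"

definition is_category :: "('o, 'm) category \<Rightarrow> bool" where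
  "is_category C \<longleftrightarrow>
     (\<forall>X\<in>cat_ob C. cat_id C X \<in> cat_hom C X X) \<and>
     (\<forall>X\<in>cat_ob C. \<forall>Y\<in>cat_ob C. \<forall>f\<in>cat_hom C X Y.
        cat_comp C X X Y f (cat_id C X) = f \<and> cat_comp C X Y Y (cat_id C Y) f = f) \<and>
     (\<forall>X\<in>cat_ob C. \<forall>Y\<in>cat_ob C. \<forall>Z\<in>cat_ob C. \<forall>f\<in>cat_hom C X Y. \<forall>g\<in>cat_hom C Y Z.
        cat_comp C X Y Z g f \<in> cat_hom C X Z) \<and>
     (\<forall>W\<in>cat_ob C. \<forall>X\<in>cat_ob C. \<forall>Y\<in>cat_ob C. \<forall>Z\<in>cat_ob C.
        \<forall>f\<in>cat_hom C W X. \<forall>g\<in>cat_hom C X Y. \<forall>h\<in>cat_hom C Y Z.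
          cat_comp C W X Z (cat_comp C X Y Z h g) f = cat_comp C W Y Z h (cat_comp C W X Y g f))"

record ('o, 'm, 'p, 'n) cat_functor =
  fun_ob :: "'o \<Rightarrow> 'p"
  fun_hom :: "'o \<Rightarrow> 'o \<Rightarrow> 'm \<Rightarrow> 'n"

definition is_functor ::
  "('o, 'm) category \<Rightarrow> ('p, 'n) category \<Rightarrow> ('o, 'm, 'p, 'n) cat_functor \<Rightarrow> bool" where
  "is_functor C D F \<longleftrightarrow>
     is_category C \<and> is_category D \<and>
     (\<forall>X\<in>cat_ob C. fun_ob F X \<in> cat_ob D) \<and>
     (\<forall>X\<in>cat_ob C. \<forall>Y\<in>cat_ob C. \<forall>f\<in>cat_hom C X Y.
        fun_hom F X Y f \<in> cat_hom D (fun_ob F X) (fun_ob F Y)) \<and>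
     (\<forall>X\<in>cat_ob C. fun_hom F X X (cat_id C X) = cat_id D (fun_ob F X)) \<and>
     (\<forall>X\<in>cat_ob C. \<forall>Y\<in>cat_ob C. \<forall>Z\<in>cat_ob C. \<forall>f\<in>cat_hom C X Y. \<forall>g\<in>cat_hom C Y Z.
        fun_hom F X Z (cat_comp C X Y Z g f) =
        cat_comp D (fun_ob F X) (fun_ob F Y) (fun_ob F Z) (fun_hom F Y Z g) (fun_hom F X Y f))"

text \<open>\<open>left_inverse_functor C F G\<close> says that \<open>G\<close> composed with \<open>F\<close> is the identity functor of
  \<open>C\<close>, strictly on objects and arrows.\<close>

definition left_inverse_functor ::
  "('o, 'm) category \<Rightarrow> ('o, 'm, 'p, 'n) cat_functor \<Rightarrow> ('p, 'n, 'o, 'm) cat_functor \<Rightarrow> bool" where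
  "left_inverse_functor C F G \<longleftrightarrow>
     (\<forall>X\<in>cat_ob C. fun_ob G (fun_ob F X) = X) \<and>
     (\<forall>X\<in>cat_ob C. \<forall>Y\<in>cat_ob C. \<forall>f\<in>cat_hom C X Y.
        fun_hom G (fun_ob F X) (fun_ob F Y) (fun_hom F X Y f) = f)"

definition category_isomorphism ::
  "('o, 'm) category \<Rightarrow> ('p, 'n) category \<Rightarrow>
   ('o, 'm, 'p, 'n) cat_functor \<Rightarrow> ('p, 'n, 'o, 'm) cat_functor \<Rightarrow> bool" where
  "category_isomorphism C D F G \<longleftrightarrow>
     is_functor C D F \<and> is_functor D C G \<and> left_inverse_functor C F G \<and> left_inverse_functor D G F"

text \<open>The type \<open>'x\<close> is the universe of points: the objects are all spaces whose carrier is an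
  arbitrary (possibly empty) subset of \<open>'x\<close>.\<close>

definition special_sspace_category ::
  "(('s::inverse_semigroup, 'x) sspace, 'x \<Rightarrow> 'x) category" where
  "special_sspace_category =
     \<lparr>cat_ob = {X. special_sspace X},
      cat_hom = sspace_hom,
      cat_id = (\<lambda>X. restrict id (topspace (sp_top X))),
      cat_comp = (\<lambda>X Y Z g f. compose (topspace (sp_top X)) g f)\<rparr>"

definition gspace_category ::
  "('g, 'b) groupoid \<Rightarrow> (('g, 'b, 'x) gspace, 'x \<Rightarrow> 'x) category" where
  "gspace_category G =
     \<lparr>cat_ob = {X. is_gspace G X},
      cat_hom = gspace_hom G,
      cat_id = (\<lambda>X. restrict id (topspace (gsp_top X))),
      cat_comp = (\<lambda>X Y Z g f. compose (topspace (gsp_top X)) g f)\<rparr>"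

end

theory Submission
  imports Defs
begin

text \<open>
  A point \<open>x\<close> of a special \<open>S\<close>-space determines the character \<open>p(x)\<close> that takes the value 1 at \<open>e\<close>
  exactly if \<open>x \<in> X\<^sub>e\<close>, and \<open>p\<close> is continuous because the \<open>X\<^sub>e\<close> are clopen. Since \<open>p(x)\<close> lies in
  the domain of \<open>s\<close> exactly if \<open>x\<close> does, \<open>[s, p(x)] = [t, p(x)]\<close> holds exactly if \<open>[s, x] = [t, x]\<close>.
  So \<open>[s, p(x)] x = s x\<close> is a well-defined action of the universal groupoid and
  \<open>[s, x] \<mapsto> ([s, p(x)], x)\<close> is a bijection onto the semidirect product, which matches the basic
  open sets of the two groupoids. Conversely a groupoid space with anchor \<open>p\<close> is an \<open>S\<close>-space under
  \<open>s x = [s, p(x)] x\<close>; it is special because the sets of characters with value 1 at \<open>e\<close> are clopen.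
\<close>

section \<open>Inverse semigroups\<close>

text \<open>An isomorphism of categories, unlike an equivalence, demands literal equality of
  records, also outside the carriers. The \<open>extensional\<close> clauses make this possible:
  both round trips on objects end by comparing functions on a carrier and their default value
  elsewhere. The action on characters by \<open>\<phi> (star s * e * s)\<close> is the one that
  makes \<open>p\<close> equivariant, because \<open>s x\<close> lies in the domain of
  \<open>e\<close> exactly if \<open>x\<close> lies in the domain of \<open>star s * e * s\<close>.
  Two points need preparation. Homeomorphy is awkward to check for a constructed action; it is
  enough that idempotents act as partial identities, since \<open>star s\<close> then acts as the
  inverse of \<open>s\<close> and only continuity remains. And the space of germs is given merely by
  generating sets; \<open>openin_germ_nhd\<close> turns these into a basis with a prescribed
  representative, after which continuity is a matter of one element \<open>s\<close> at a
  time.\<close>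

lemma mult_star_mult [simp]: "s * star s * s = s"
  and star_mult_star [simp]: "star s * s * star s = star s"
proof -
  have "s = s * star s * s \<and> star s = star s * s * star s"
    unfolding star_def by (rule theI') (rule ex1_star)
  then show "s * star s * s = s" "star s * s * star s = star s" by simp_all
qed

lemma mult_star_mult' [simp]: "s * (star s * s) = s"
  and star_mult_star' [simp]: "star s * (s * star s) = star s"
  using mult_star_mult[of s] star_mult_star[of s] by (simp_all only: mult.assoc)

lemma mult_star_mult_left [simp]: "s * (star s * (s * t)) = s * t"
  and star_mult_star_left [simp]: "star s * (s * (star s * t)) = star s * t"
  using mult_star_mult[of s] star_mult_star[of s] by (metis mult.assoc)+

lemma star_eqI:
  assumes "s * t * s = s" "t * s * t = t"
  shows "star s = t"
  using assms ex1_star[of s] mult_star_mult[of s] star_mult_star[of s] by metis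

lemma star_star [simp]: "star (star s) = s"
  by (rule star_eqI) simp_all

lemma idempotents_iff: "e \<in> idempotents \<longleftrightarrow> e * e = e"
  by (simp add: idempotents_def)

lemma idempotents_left [simp]: "e \<in> idempotents \<Longrightarrow> e * (e * s) = e * s"
  by (metis idempotents_iff mult.assoc)

lemma star_idempotent [simp]: "e \<in> idempotents \<Longrightarrow> star e = e"
  by (rule star_eqI) (simp_all add: idempotents_iff)

lemma star_mult_idempotent [simp, intro]: "star s * s \<in> idempotents"
  and mult_star_idempotent [simp, intro]: "s * star s \<in> idempotents"
  by (simp_all add: idempotents_iff mult.assoc)

text \<open>If \<open>x\<close> inverts \<open>e * f\<close>, then so does \<open>f * x * e\<close>.
  Uniqueness makes the two equal, and the second form shows that \<open>x\<close> is idempotent. An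
  idempotent is its own inverse, so \<open>e * f\<close>, being the inverse of \<open>x\<close>, is
  \<open>x\<close> itself.\<close>

lemma mult_idempotents [simp, intro]:
  assumes e: "e \<in> idempotents" and f: "f \<in> idempotents"
  shows "e * f \<in> idempotents"
proof -
  define x where "x = star (e * f)"
  have 1: "e * (f * (x * (e * f))) = e * f" and 2: "x * (e * (f * x)) = x"
    using mult_star_mult[of "e * f"] star_mult_star[of "e * f"] by (simp_all add: x_def mult.assoc)
  have 3: "x * (e * (f * (x * t))) = x * t" for t
    using 2 by (metis mult.assoc)
  have "x = f * x * e"
    unfolding x_def
    by (rule star_eqI) (use e f 1 3 in \<open>simp_all add: mult.assoc flip: x_def\<close>)
  then have "x * x = (f * x * e) * (f * x * e)" by simp
  also have "\<dots> = f * x * e"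
    using 3 by (simp add: mult.assoc)
  finally have "x \<in> idempotents"
    using \<open>x = f * x * e\<close> by (simp add: idempotents_iff)
  moreover have "e * f = star x"
    by (simp add: x_def)
  ultimately show ?thesis by simp
qed

text \<open>Both products are idempotent, hence \<open>e * f\<close> and \<open>f * e\<close> invert
  each other, while an idempotent is its own inverse.\<close>

lemma idempotents_commute:
  assumes e: "e \<in> idempotents" and f: "f \<in> idempotents"
  shows "e * f = f * e"
proof -
  have "e * (f * (e * f)) = e * f" "f * (e * (f * e)) = f * e"
    using mult_idempotents[OF e f] mult_idempotents[OF f e] by (simp_all add: idempotents_iff mult.assoc)
  then have "star (e * f) = f * e"
    by (intro star_eqI) (use e f in \<open>simp_all add: mult.assoc\<close>)
  then show ?thesis
    using e f by simp
qed

text \<open>Commuting \<open>e\<close> with \<open>s * star s\<close> moves it to the right of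
  \<open>s\<close> at the price of conjugation. The natural order is defined by idempotents on the
  right, so this move is what makes it compatible with products and with
  \<open>star\<close>.\<close>

lemma idempotent_mult_eq:
  assumes "e \<in> idempotents"
  shows "e * s = s * (star s * (e * s))"
proof -
  have "e * s = (e * (s * star s)) * s" by (simp add: mult.assoc)
  also have "\<dots> = ((s * star s) * e) * s"
    using assms by (simp only: idempotents_commute[of e "s * star s"] mult_star_idempotent)
  finally show ?thesis by (simp add: mult.assoc)
qed

lemma conjugate_idempotent [simp, intro]:
  assumes "e \<in> idempotents"
  shows "star s * (e * s) \<in> idempotents"
  using assms idempotent_mult_eq[OF assms, of s] by (simp add: idempotents_iff mult.assoc)

text \<open>The idempotents \<open>t * star t\<close> and \<open>star s * s\<close> meet in the
  middle of each triple product; exchanging them lets the outer factors absorb them.\<close>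

lemma star_mult: "star (s * t) = star t * star s"
proof (rule star_eqI)
  have *: "t * star t * (star s * s) = star s * s * (t * star t)"
    by (rule idempotents_commute) simp_all
  have "s * t * (star t * star s) * (s * t) = s * (t * star t * (star s * s)) * t"
    by (simp add: mult.assoc)
  also have "\<dots> = s * t"
    unfolding * by (simp add: mult.assoc)
  finally show "s * t * (star t * star s) * (s * t) = s * t" .
  have "star t * star s * (s * t) * (star t * star s) = star t * (star s * s * (t * star t)) * star s"
    by (simp add: mult.assoc)
  also have "\<dots> = star t * star s"
    unfolding *[symmetric] by (simp add: mult.assoc)
  finally show "star t * star s * (s * t) * (star t * star s) = star t * star s" .
qed

lemma natural_leI: "e \<in> idempotents \<Longrightarrow> natural_le (s * e) s"
  by (auto simp: natural_le_def)

lemma natural_leE: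
  assumes "natural_le u s"
  obtains e where "e \<in> idempotents" "u = s * e"
  using assms by (auto simp: natural_le_def)

lemma natural_le_refl [simp, intro]: "natural_le s s"
  using natural_leI[of "star s * s" s] by simp

lemma natural_le_mult:
  assumes "natural_le u s" "natural_le v t"
  shows "natural_le (u * v) (s * t)"
proof -
  obtain e f where e: "e \<in> idempotents" "u = s * e" and f: "f \<in> idempotents" "v = t * f"
    using assms by (auto elim!: natural_leE)
  have "u * v = s * (e * t) * f"
    by (simp add: e f mult.assoc)
  also have "\<dots> = s * (t * (star t * (e * t))) * f"
    using idempotent_mult_eq[OF e(1), of t] by simp
  finally have "u * v = (s * t) * (star t * (e * t) * f)"
    by (simp add: mult.assoc)
  then show ?thesis
    using e f by (metis natural_leI mult_idempotents conjugate_idempotent)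
qed

lemma natural_le_star:
  assumes "natural_le u s"
  shows "natural_le (star u) (star s)"
proof -
  obtain e where e: "e \<in> idempotents" "u = s * e"
    using assms by (rule natural_leE)
  have "star u = star s * (s * (e * star s))"
    using e idempotent_mult_eq[OF e(1), of "star s"] by (simp add: star_mult)
  moreover have "s * (e * star s) \<in> idempotents"
    using conjugate_idempotent[OF e(1), of "star s"] by simp
  ultimately show ?thesis by (simp add: natural_leI)
qed

section \<open>Spaces over an inverse semigroup\<close>

lemma sp_dom_iff: "x \<in> sp_dom X s \<longleftrightarrow> sp_act X s x = Some (sp_app X s x)"
  by (auto simp: sp_dom_def sp_app_def)

lemma the_sp_act: "(\<lambda>x. the (sp_act X s x)) = sp_app X s"
  by (simp add: sp_app_def fun_eq_iff)

lemma sp_actD: "sp_act X s x = Some y \<Longrightarrow> x \<in> sp_dom X s \<and> sp_app X s x = y"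
  by (auto simp: sp_dom_def sp_app_def)

text \<open>The algebraic core of an S-space; both assumptions concern only the partial maps. They
  already force \<open>star s\<close> to act as the inverse of \<open>s\<close>.\<close>

locale action =
  fixes X :: "('s::inverse_semigroup, 'x) sspace"
  assumes act_mult: "sp_act X (s * t) = sp_act X s \<circ>\<^sub>m sp_act X t"
    and act_idempotent: "e \<in> idempotents \<Longrightarrow> sp_act X e x = Some y \<Longrightarrow> y = x"
begin

lemma act_mult_iff: "sp_act X (s * t) x = Some z \<longleftrightarrow> (\<exists>y. sp_act X t x = Some y \<and> sp_act X s y = Some z)"
  by (simp add: act_mult map_comp_Some_iff)

text \<open>Since \<open>s = s * (star s * s)\<close>, the idempotent \<open>star s * s\<close> is
  defined wherever \<open>s\<close> is, and it fixes such a point. Read as \<open>star s\<close>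
  after \<open>s\<close>, this says that \<open>star s\<close> leads back; the same argument for
  \<open>star s\<close> gives the converse.\<close>

lemma act_star: "sp_act X (star s) y = Some x \<longleftrightarrow> sp_act X s x = Some y"
proof -
  have "sp_act X (star s) y = Some x" if *: "sp_act X s x = Some y" for s x y
  proof -
    have "sp_act X (s * (star s * s)) x = Some y"
      unfolding mult_star_mult' by (rule *)
    then obtain z where z: "sp_act X (star s * s) x = Some z"
      unfolding act_mult_iff[of s] by blast
    then show ?thesis
      using act_idempotent[OF _ z] z * by (auto simp: act_mult_iff)
  qed
  from this[of s x y] this[of "star s" y x] show ?thesis by auto
qed

lemma dom_star_mult [simp]: "sp_dom X (star s * s) = sp_dom X s"
proof -
  have "x \<in> sp_dom X (star s * s) \<longleftrightarrow> x \<in> sp_dom X s" for x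
  proof -
    have "(\<exists>z. sp_act X (star s * s) x = Some z) \<longleftrightarrow> (\<exists>y. sp_act X s x = Some y)"
      unfolding act_mult_iff using act_star by blast
    then show ?thesis by (simp add: sp_dom_def domIff)
  qed
  then show ?thesis by blast
qed

lemma dom_mult_iff: "x \<in> sp_dom X (s * t) \<longleftrightarrow> x \<in> sp_dom X t \<and> sp_app X t x \<in> sp_dom X s"
  by (auto simp: sp_dom_def sp_app_def act_mult map_comp_def split: option.splits)

lemma app_mult: "x \<in> sp_dom X (s * t) \<Longrightarrow> sp_app X (s * t) x = sp_app X s (sp_app X t x)"
  by (metis act_mult_iff dom_mult_iff sp_actD sp_dom_iff)

lemma app_idempotent: "e \<in> idempotents \<Longrightarrow> x \<in> sp_dom X e \<Longrightarrow> sp_app X e x = x"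
  by (metis act_idempotent sp_dom_iff)

lemma app_star_app: "x \<in> sp_dom X s \<Longrightarrow> sp_app X (star s) (sp_app X s x) = x"
  by (metis act_star sp_actD sp_dom_iff)

lemma app_in_dom_star: "x \<in> sp_dom X s \<Longrightarrow> sp_app X s x \<in> sp_dom X (star s)"
  by (metis act_star sp_actD sp_dom_iff)

lemma dom_natural_le: "natural_le u s \<Longrightarrow> x \<in> sp_dom X u \<Longrightarrow> x \<in> sp_dom X s"
  by (auto elim!: natural_leE simp: dom_mult_iff app_idempotent)

lemma app_natural_le: "natural_le u s \<Longrightarrow> x \<in> sp_dom X u \<Longrightarrow> sp_app X u x = sp_app X s x"
  by (auto elim!: natural_leE simp: app_mult) (auto simp: dom_mult_iff app_idempotent)

text \<open>This is the origin of the conjugation in the action on characters, and the reason why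
  the anchor is equivariant.\<close>

lemma app_in_dom_iff:
  assumes "e \<in> idempotents" "x \<in> sp_dom X s"
  shows "sp_app X s x \<in> sp_dom X e \<longleftrightarrow> x \<in> sp_dom X (star s * (e * s))"
  using assms by (auto simp: dom_mult_iff app_mult app_idempotent app_in_dom_star)

text \<open>The continuity assumption for \<open>star s\<close> supplies continuity of the inverse
  of \<open>sp_app X s\<close>, so homeomorphy follows.\<close>

lemma is_sspaceI:
  assumes open_dom: "\<And>s. openin (sp_top X) (sp_dom X s)"
    and cont: "\<And>s. continuous_map (subtopology (sp_top X) (sp_dom X s)) (sp_top X) (sp_app X s)"
    and cover: "\<And>x. x \<in> topspace (sp_top X) \<Longrightarrow> \<exists>e\<in>idempotents. x \<in> sp_dom X e"
  shows "is_sspace X"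
  unfolding is_sspace_def
proof (intro conjI allI)
  fix s
  have ran: "ran (sp_act X s) = sp_dom X (star s)" for s
    unfolding ran_def sp_dom_def by (auto simp: act_star[of s])
  have "homeomorphic_maps (subtopology (sp_top X) (sp_dom X s))
          (subtopology (sp_top X) (sp_dom X (star s))) (sp_app X s) (sp_app X (star s))"
    unfolding homeomorphic_maps_def continuous_map_in_subtopology
    using cont[of s] cont[of "star s"] app_star_app[of _ s] app_star_app[of _ "star s"]
      app_in_dom_star[of _ s] app_in_dom_star[of _ "star s"] by auto
  then show "sp_act X s \<in> partial_homeos (sp_top X)"
    using open_dom[of s] open_dom[of "star s"]
    by (auto simp: partial_homeos_def ran homeomorphic_map_maps the_sp_act simp flip: sp_dom_def)
next
  show "topspace (sp_top X) = (\<Union>e\<in>idempotents. sp_dom X e)"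
    using cover open_dom by (blast dest: openin_subset)
qed (rule act_mult)

end

locale sspace = action X for X :: "('s::inverse_semigroup, 'x) sspace" +
  assumes open_dom: "openin (sp_top X) (sp_dom X s)"
    and cont_app: "continuous_map (subtopology (sp_top X) (sp_dom X s)) (sp_top X) (sp_app X s)"
    and cover: "x \<in> topspace (sp_top X) \<Longrightarrow> \<exists>e\<in>idempotents. x \<in> sp_dom X e"
begin

lemma dom_topspace: "x \<in> sp_dom X s \<Longrightarrow> x \<in> topspace (sp_top X)"
  using open_dom openin_subset by blast

lemma topspace_dom: "topspace (subtopology (sp_top X) (sp_dom X s)) = sp_dom X s"
  using dom_topspace by auto

lemma openin_dom_preimage:
  assumes "continuous_map (subtopology (sp_top X) (sp_dom X s)) T h" "openin T V"
  shows "openin (sp_top X) {x \<in> sp_dom X s. h x \<in> V}"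
  using openin_continuous_map_preimage[OF assms]
  unfolding topspace_dom openin_open_subtopology[OF open_dom] by blast

lemma app_topspace: "x \<in> sp_dom X s \<Longrightarrow> sp_app X s x \<in> topspace (sp_top X)"
  using app_in_dom_star dom_topspace by blast

end

lemma sspaceI:
  assumes "is_sspace X"
  shows "sspace X"
proof
  show mult: "sp_act X (s * t) = sp_act X s \<circ>\<^sub>m sp_act X t" for s t
    using assms by (simp add: is_sspace_def)
  have homeo: "sp_act X s \<in> partial_homeos (sp_top X)" for s
    using assms by (simp add: is_sspace_def)
  then have hm: "homeomorphic_map (subtopology (sp_top X) (sp_dom X s))
      (subtopology (sp_top X) (ran (sp_act X s))) (sp_app X s)" for s
    by (simp add: partial_homeos_def sp_dom_def the_sp_act)
  show "openin (sp_top X) (sp_dom X s)" for s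
    using homeo by (simp add: partial_homeos_def sp_dom_def)
  then have top: "topspace (subtopology (sp_top X) (sp_dom X s)) = sp_dom X s" for s
    by (intro topspace_subtopology_subset openin_subset)
  show "continuous_map (subtopology (sp_top X) (sp_dom X s)) (sp_top X) (sp_app X s)" for s
    by (rule continuous_map_into_fulltopology[OF homeomorphic_imp_continuous_map[OF hm]])
  show "y = x" if e: "e \<in> idempotents" and y: "sp_act X e x = Some y" for e x y
  proof -
    \<comment> \<open>\<open>e\<close> sends both \<open>x\<close> and \<open>y\<close> to
      \<open>y\<close>, and partial homeomorphisms are injective.\<close>
    have "sp_act X (e * e) x = Some y" using e y by (simp add: idempotents_iff)
    then have "sp_act X e y = Some y"
      using y by (simp add: mult map_comp_Some_iff)
    moreover have "inj_on (sp_app X e) (sp_dom X e)"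
      using homeomorphic_imp_injective_map[OF hm[of e]] top[of e] by simp
    ultimately show "y = x"
      using y inj_onD[of "sp_app X e" "sp_dom X e" y x] by (simp add: sp_dom_def sp_app_def domIff)
  qed
  show "\<exists>e\<in>idempotents. x \<in> sp_dom X e" if "x \<in> topspace (sp_top X)" for x
    using assms that by (simp add: is_sspace_def)
qed

section \<open>Germs\<close>

context sspace
begin

text \<open>The germ relation over a fixed point, with the domain of \<open>star u * u\<close>
  shortened to that of \<open>u\<close>. Apart from the natural order only membership in domains
  enters, so that the same \<open>u\<close> serves for a point and for its character.\<close>

definition germ_eq :: "'s \<Rightarrow> 's \<Rightarrow> 'x \<Rightarrow> bool" where
  "germ_eq s t x \<longleftrightarrow> (\<exists>u. natural_le u s \<and> natural_le u t \<and> x \<in> sp_dom X u)"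

lemma germ_eq_refl: "x \<in> sp_dom X s \<Longrightarrow> germ_eq s s x"
  by (auto simp: germ_eq_def)

lemma germ_eq_sym: "germ_eq s t x \<Longrightarrow> germ_eq t s x"
  by (auto simp: germ_eq_def)

text \<open>The two witnesses are restrictions of the same element, \<open>u = s * b\<close> and
  \<open>v = s * c\<close>. Since idempotents commute, \<open>u * c = v * b\<close>, and this
  element lies below both \<open>r\<close> and \<open>t\<close>.\<close>

lemma germ_eq_trans:
  assumes "germ_eq r s x" "germ_eq s t x"
  shows "germ_eq r t x"
proof -
  obtain u v where u: "natural_le u r" "natural_le u s" "x \<in> sp_dom X u"
    and v: "natural_le v s" "natural_le v t" "x \<in> sp_dom X v"
    using assms by (auto simp: germ_eq_def)
  obtain a b c d where e: "a \<in> idempotents" "u = r * a" "b \<in> idempotents" "u = s * b"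
     "c \<in> idempotents" "v = s * c" "d \<in> idempotents" "v = t * d"
    using u v by (auto elim!: natural_leE)
  have "u * c = v * b"
    using e by (metis mult.assoc idempotents_commute)
  then have "u * c = t * (d * b)" by (simp only: e(8) mult.assoc)
  then have "natural_le (u * c) t"
    using natural_leI[OF mult_idempotents[OF e(7,3)]] by simp
  moreover have "u * c = r * (a * c)" by (simp only: e(2) mult.assoc)
  then have "natural_le (u * c) r"
    using natural_leI[OF mult_idempotents[OF e(1,5)]] by simp
  moreover have "x \<in> sp_dom X c"
    using v e by (simp add: dom_mult_iff)
  then have "x \<in> sp_dom X (u * c)"
    by (simp add: dom_mult_iff app_idempotent u(3) e(5))
  ultimately show ?thesis
    by (auto simp: germ_eq_def)
qed

lemma germ_eq_dom: "germ_eq s t x \<Longrightarrow> x \<in> sp_dom X s \<and> x \<in> sp_dom X t"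
  by (auto simp: germ_eq_def intro: dom_natural_le)

lemma germ_eqE:
  assumes "germ_eq s t x"
  obtains u where "natural_le u s" "natural_le u t" "x \<in> sp_dom X u"
    "sp_app X s x = sp_app X u x" "sp_app X t x = sp_app X u x"
proof -
  obtain u where "natural_le u s" "natural_le u t" "x \<in> sp_dom X u"
    using assms germ_eq_def by blast
  then show thesis
    using that[of u] app_natural_le[of u s x] app_natural_le[of u t x] by simp
qed

lemma germ_eq_app: "germ_eq s t x \<Longrightarrow> sp_app X s x = sp_app X t x"
  by (erule germ_eqE) simp

lemma germ_eq_idempotents:
  assumes "e \<in> idempotents" "f \<in> idempotents" "x \<in> sp_dom X e" "x \<in> sp_dom X f"
  shows "germ_eq e f x"
proof -
  have "natural_le (e * f) e"
    using assms(2) by (rule natural_leI)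
  moreover have "natural_le (e * f) f"
    using natural_leI[of e f] idempotents_commute[OF assms(1,2)] assms(1) by simp
  moreover have "x \<in> sp_dom X (e * f)"
    using assms by (simp add: dom_mult_iff app_idempotent)
  ultimately show ?thesis
    unfolding germ_eq_def by blast
qed

lemma germ_eq_mult:
  assumes "germ_eq s s' (sp_app X t x)" "germ_eq t t' x"
  shows "germ_eq (s * t) (s' * t') x"
proof -
  obtain u where u: "natural_le u s" "natural_le u s'" "sp_app X t x \<in> sp_dom X u"
    using assms(1) by (rule germ_eqE)
  obtain v where v: "natural_le v t" "natural_le v t'" "x \<in> sp_dom X v" "sp_app X t x = sp_app X v x"
    using assms(2) by (rule germ_eqE)
  have "natural_le (u * v) (s * t)" "natural_le (u * v) (s' * t')"
    using u v by (simp_all add: natural_le_mult)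
  moreover have "x \<in> sp_dom X (u * v)"
    using u(3) v(3,4) by (simp add: dom_mult_iff)
  ultimately show ?thesis
    unfolding germ_eq_def by blast
qed

lemma germ_eq_star:
  assumes "germ_eq s t x"
  shows "germ_eq (star s) (star t) (sp_app X s x)"
proof -
  obtain u where u: "natural_le u s" "natural_le u t" "x \<in> sp_dom X u" "sp_app X s x = sp_app X u x"
    using assms by (rule germ_eqE)
  then have "natural_le (star u) (star s)" "natural_le (star u) (star t)"
    "sp_app X s x \<in> sp_dom X (star u)"
    by (simp_all add: natural_le_star app_in_dom_star)
  then show ?thesis
    unfolding germ_eq_def by blast
qed

text \<open>Allows the representative of a germ to be exchanged on a whole neighbourhood of its base
  point.\<close>

lemma open_germ_eq: "openin (sp_top X) {x. germ_eq s t x}"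
proof -
  have "{x. germ_eq s t x} = (\<Union>u\<in>{u. natural_le u s \<and> natural_le u t}. sp_dom X u)"
    by (auto simp: germ_eq_def)
  then show ?thesis
    using open_dom by auto
qed

lemma in_germ_iff: "p \<in> germ X s x \<longleftrightarrow> snd p = x \<and> germ_eq s (fst p) x"
proof -
  have "p \<in> germ X s x \<longleftrightarrow> snd p = x \<and> germ_eq s (fst p) x \<and> x \<in> sp_dom X s \<and> x \<in> sp_dom X (fst p)"
    by (cases p) (auto simp: germ_def germ_rel_def germ_eq_def)
  then show ?thesis
    using germ_eq_dom by blast
qed

lemma germ_mem: "x \<in> sp_dom X s \<Longrightarrow> (s, x) \<in> germ X s x"
  by (simp add: in_germ_iff germ_eq_refl)

lemma germ_eqI: "germ_eq s t x \<Longrightarrow> germ X s x = germ X t x"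
  by (rule set_eqI) (unfold in_germ_iff, blast intro: germ_eq_sym germ_eq_trans)

lemma germ_eq_iff: "x \<in> sp_dom X s \<Longrightarrow> germ X s x = germ X t y \<longleftrightarrow> x = y \<and> germ_eq s t x"
  by (metis germ_mem germ_eqI germ_eq_sym in_germ_iff fst_conv snd_conv)

text \<open>The operations of \<open>germ_groupoid\<close> are \<open>the_elem\<close> of an image
  or a union over representatives; both are evaluated by noting that a function constant on a germ
  has a one-point image.\<close>

lemma germ_image:
  assumes "x \<in> sp_dom X s" "\<And>t. germ_eq s t x \<Longrightarrow> f (t, x) = c"
  shows "f ` germ X s x = {c}"
proof -
  have "f p = c" if "p \<in> germ X s x" for p
    using that assms(2)[of "fst p"] by (cases p) (auto simp: in_germ_iff)
  then show ?thesis
    using germ_mem[OF assms(1)] by auto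
qed

definition germs :: "('s \<times> 'x) set set" where
  "germs = {germ X s x | s x. x \<in> sp_dom X s}"

lemma germs_cases:
  assumes "g \<in> germs"
  obtains s x where "x \<in> sp_dom X s" "g = germ X s x"
  using assms by (auto simp: germs_def)

lemma germ_in_germs [intro]: "x \<in> sp_dom X s \<Longrightarrow> germ X s x \<in> germs"
  by (auto simp: germs_def)

lemma gpd_units_germ [simp]: "gpd_units (germ_groupoid X) = sp_top X"
  by (simp add: germ_groupoid_def)

lemma gpd_dom_germ: "x \<in> sp_dom X s \<Longrightarrow> gpd_dom (germ_groupoid X) (germ X s x) = x"
  by (simp add: germ_groupoid_def germ_image[where c = x])

lemma gpd_ran_germ: "x \<in> sp_dom X s \<Longrightarrow> gpd_ran (germ_groupoid X) (germ X s x) = sp_app X s x"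
  by (simp add: germ_groupoid_def germ_image[where c = "sp_app X s x"] germ_eq_app)

lemma gpd_unit_germ:
  assumes "e \<in> idempotents" "x \<in> sp_dom X e"
  shows "gpd_unit (germ_groupoid X) x = germ X e x"
proof -
  have "(\<lambda>f. germ X f x) ` {f \<in> idempotents. x \<in> sp_dom X f} = {germ X e x}"
    using assms germ_eqI[OF germ_eq_idempotents] by blast
  then show ?thesis
    by (simp add: germ_groupoid_def)
qed

lemma UN_germ:
  assumes "x \<in> sp_dom X s" "\<And>t. germ_eq s t x \<Longrightarrow> F t x = C"
  shows "(\<Union>(t, y)\<in>germ X s x. F t y) = C"
proof -
  have "(\<lambda>(t, y). F t y) ` germ X s x = {C}"
    using assms by (intro germ_image) simp_all
  then show ?thesis by simp
qed

lemma gpd_mult_germ: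
  assumes "x \<in> sp_dom X t" "sp_app X t x \<in> sp_dom X s"
  shows "gpd_mult (germ_groupoid X) (germ X s (sp_app X t x)) (germ X t x) = germ X (s * t) x"
proof -
  have "(\<Union>(s', z)\<in>germ X s (sp_app X t x). \<Union>(t', y)\<in>germ X t x. germ X (s' * t') y) = germ X (s * t) x"
  proof (intro UN_germ assms)
    fix s' t'
    assume "germ_eq s s' (sp_app X t x)" "germ_eq t t' x"
    then show "germ X (s' * t') x = germ X (s * t) x"
      by (intro germ_eqI germ_eq_sym[OF germ_eq_mult])
  qed
  then show ?thesis
    by (simp add: germ_groupoid_def)
qed

lemma gpd_inv_germ:
  assumes "x \<in> sp_dom X s"
  shows "gpd_inv (germ_groupoid X) (germ X s x) = germ X (star s) (sp_app X s x)"
proof -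
  have "(\<Union>(t, y)\<in>germ X s x. germ X (star t) (sp_app X t y)) = germ X (star s) (sp_app X s x)"
    using assms
  proof (rule UN_germ)
    fix t assume "germ_eq s t x"
    then show "germ X (star t) (sp_app X t x) = germ X (star s) (sp_app X s x)"
      using germ_eqI[OF germ_eq_star] germ_eq_app by metis
  qed
  then show ?thesis
    by (simp add: germ_groupoid_def)
qed

lemma gpd_arrows_germ:
  "gpd_arrows (germ_groupoid X) =
     topology_generated_by {germ X s ` U | s U. openin (sp_top X) U \<and> U \<subseteq> sp_dom X s}"
  by (simp add: germ_groupoid_def)

lemma openin_germ_image:
  "openin (sp_top X) U \<Longrightarrow> U \<subseteq> sp_dom X s \<Longrightarrow> openin (gpd_arrows (germ_groupoid X)) (germ X s ` U)"
  unfolding gpd_arrows_germ by (rule topology_generated_by_Basis) auto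

lemma topspace_gpd_arrows_germ [simp]: "topspace (gpd_arrows (germ_groupoid X)) = germs"
  unfolding gpd_arrows_germ topology_generated_by_topspace germs_def
  using open_dom by blast

text \<open>Induction over the generation of open sets: a generator may be written with another
  representative than \<open>s\<close>, but the two agree near \<open>x\<close>, and finite
  intersections and unions preserve the property. So the generating sets form a basis.\<close>

lemma openin_germ_nhd:
  assumes "openin (gpd_arrows (germ_groupoid X)) W" "x \<in> sp_dom X s" "germ X s x \<in> W"
  shows "\<exists>U. openin (sp_top X) U \<and> x \<in> U \<and> U \<subseteq> sp_dom X s \<and> germ X s ` U \<subseteq> W"
  using assms(1)[unfolded gpd_arrows_germ openin_topology_generated_by_iff] assms(2,3)
proof (induction)
  case (Int A B)
  then obtain U V where "openin (sp_top X) U" "x \<in> U" "U \<subseteq> sp_dom X s" "germ X s ` U \<subseteq> A"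
    "openin (sp_top X) V" "x \<in> V" "germ X s ` V \<subseteq> B" by blast
  then show ?case
    by (intro exI[of _ "U \<inter> V"] conjI openin_Int) blast+
next
  case (UN K)
  then show ?case by (meson UnionE Union_upper order_trans)
next
  case (Basis A)
  then obtain t U where U: "openin (sp_top X) U" "U \<subseteq> sp_dom X t" "A = germ X t ` U"
    by blast
  then obtain y where "y \<in> U" "germ X s x = germ X t y"
    using Basis.prems by blast
  then have "x \<in> U" and eq: "germ_eq s t x"
    using germ_eq_iff[OF Basis.prems(1), of t y] by auto
  \<comment> \<open>Where \<open>s\<close> and \<open>t\<close> have the same germ, the generator
    given by \<open>t\<close> may be described by \<open>s\<close>; this region is open.\<close>
  have "germ X s ` (U \<inter> {y. germ_eq s t y}) \<subseteq> A"
    using germ_eqI[of s t] U(3) by blast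
  moreover have "openin (sp_top X) (U \<inter> {y. germ_eq s t y})"
    using U(1) open_germ_eq by (rule openin_Int)
  moreover have "U \<inter> {y. germ_eq s t y} \<subseteq> sp_dom X s"
    using germ_eq_dom by blast
  ultimately show ?case
    using \<open>x \<in> U\<close> eq by blast
qed simp

lemma continuous_map_germ:
  "continuous_map (subtopology (sp_top X) (sp_dom X s)) (gpd_arrows (germ_groupoid X)) (germ X s)"
proof -
  have "openin (sp_top X) {x \<in> sp_dom X s. germ X s x \<in> W}"
    if W: "openin (gpd_arrows (germ_groupoid X)) W" for W
  proof (subst openin_subopen, safe)
    fix x assume "x \<in> sp_dom X s" "germ X s x \<in> W"
    from openin_germ_nhd[OF W this]
    show "\<exists>T. openin (sp_top X) T \<and> x \<in> T \<and> T \<subseteq> {x \<in> sp_dom X s. germ X s x \<in> W}"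
      by blast
  qed
  moreover have "germ X s \<in> sp_dom X s \<rightarrow> germs" by blast
  ultimately show ?thesis
    unfolding continuous_map topspace_dom openin_open_subtopology[OF open_dom]
    by (auto simp del: topspace_subtopology)
qed

text \<open>The images of open sets under each \<open>germ X s\<close> are open, and together they
  cover the arrows; a preimage is therefore a union of open pieces, one for each
  \<open>s\<close>.\<close>

lemma continuous_map_from_germ:
  assumes "\<And>s. continuous_map (subtopology (sp_top X) (sp_dom X s)) T (\<lambda>x. f (germ X s x))"
  shows "continuous_map (gpd_arrows (germ_groupoid X)) T f"
  unfolding continuous_map_def topspace_gpd_arrows_germ
proof safe
  fix g assume "g \<in> germs"
  then obtain s x where "x \<in> sp_dom X s" "g = germ X s x"
    by (rule germs_cases)
  then show "f g \<in> topspace T"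
    using continuous_map_funspace[OF assms[of s]] dom_topspace by auto
next
  fix V assume V: "openin T V"
  have *: "openin (sp_top X) {x \<in> sp_dom X s. f (germ X s x) \<in> V}" for s
    using assms V by (rule openin_dom_preimage)
  have "openin (gpd_arrows (germ_groupoid X))
      (\<Union>s. germ X s ` {x \<in> sp_dom X s. f (germ X s x) \<in> V})"
    using openin_germ_image[OF *] by (intro openin_Union) blast
  moreover have "{g \<in> germs. f g \<in> V} = (\<Union>s. germ X s ` {x \<in> sp_dom X s. f (germ X s x) \<in> V})"
    unfolding germs_def by blast
  ultimately show "openin (gpd_arrows (germ_groupoid X)) {g \<in> germs. f g \<in> V}"
    by simp
qed

end

section \<open>The universal groupoid\<close>

lemma characters_mult:
  "\<phi> \<in> characters \<Longrightarrow> e \<in> idempotents \<Longrightarrow> f \<in> idempotents \<Longrightarrow> \<phi> (e * f) \<longleftrightarrow> \<phi> e \<and> \<phi> f"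
  by (simp add: characters_def)

lemma characters_eqI:
  assumes "\<phi> \<in> characters" "\<psi> \<in> characters" "\<And>e. e \<in> idempotents \<Longrightarrow> \<phi> e = \<psi> e"
  shows "\<phi> = \<psi>"
  using assms by (intro extensionalityI[of _ idempotents]) (auto simp: characters_def)

lemma topspace_character_topology [simp]: "topspace character_topology = characters"
  by (auto simp: character_topology_def characters_def PiE_def)

lemma continuous_map_into_characters:
  "continuous_map T character_topology f \<longleftrightarrow>
     f \<in> topspace T \<rightarrow> characters \<and>
     (\<forall>e\<in>idempotents. continuous_map T (discrete_topology UNIV) (\<lambda>x. f x e))"
proof -
  have "f ` topspace T \<subseteq> extensional idempotents" if "f \<in> topspace T \<rightarrow> characters"
    using that by (auto simp: characters_def)
  then show ?thesis
    unfolding character_topology_def continuous_map_in_subtopology continuous_map_componentwise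
    by blast
qed

lemma continuous_map_character_eval:
  "e \<in> idempotents \<Longrightarrow> continuous_map character_topology (discrete_topology UNIV) (\<lambda>\<phi>. \<phi> e)"
  by (rule continuous_map_into_characters
        [THEN iffD1, OF continuous_map_id, THEN conjunct2, rule_format, unfolded id_apply])

lemma basic_D_clopen:
  assumes "e \<in> idempotents"
  shows "openin character_topology (basic_D e)" "closedin character_topology (basic_D e)"
proof -
  have "basic_D e = {\<phi> \<in> topspace character_topology. \<phi> e \<in> {True}}"
    by (auto simp: basic_D_def)
  then show "openin character_topology (basic_D e)" "closedin character_topology (basic_D e)"
    using openin_continuous_map_preimage[OF continuous_map_character_eval[OF assms], of "{True}"]
      closedin_continuous_map_preimage[OF continuous_map_character_eval[OF assms], of "{True}"]
    by simp_all
qed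

lemma sp_top_character [simp]: "sp_top character_sspace = character_topology"
  by (simp add: character_sspace_def)

lemma sp_act_character:
  "sp_act character_sspace s \<phi> =
     (if \<phi> \<in> basic_D (star s * s) then Some (\<lambda>e\<in>idempotents. \<phi> (star s * (e * s))) else None)"
  by (simp add: character_sspace_def mult.assoc)

lemma sp_dom_character: "sp_dom character_sspace s = basic_D (star s * s)"
  by (auto simp: sp_dom_def sp_act_character split: if_splits)

lemma sp_app_character:
  "\<phi> \<in> basic_D (star s * s) \<Longrightarrow>
     sp_app character_sspace s \<phi> = (\<lambda>e\<in>idempotents. \<phi> (star s * (e * s)))"
  by (simp add: sp_app_def sp_act_character)

text \<open>Moving \<open>f\<close> across \<open>s\<close> writes the conjugate of
  \<open>e * f\<close> as the product of the conjugates of \<open>e\<close> and \<open>f\<close>,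
  which gives multiplicativity.\<close>

lemma translate_in_characters:
  assumes "\<phi> \<in> basic_D (star s * s)"
  shows "(\<lambda>e\<in>idempotents. \<phi> (star s * (e * s))) \<in> characters"
proof -
  have \<phi>: "\<phi> \<in> characters" "\<phi> (star s * s)"
    using assms by (auto simp: basic_D_def)
  have "\<phi> (star s * (e * f * s)) \<longleftrightarrow> \<phi> (star s * (e * s)) \<and> \<phi> (star s * (f * s))"
    if e: "e \<in> idempotents" and f: "f \<in> idempotents" for e f
  proof -
    have "star s * (e * f * s) = star s * (e * (f * s))"
      by (simp add: mult.assoc)
    also have "\<dots> = (star s * (e * s)) * (star s * (f * s))"
      by (subst idempotent_mult_eq[OF f]) (simp add: mult.assoc)
    finally show ?thesis
      using e f \<phi> by (simp add: characters_mult)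
  qed
  \<comment> \<open>The idempotent \<open>s * star s\<close> conjugates to
    \<open>star s * s\<close>, where \<open>\<phi>\<close> has value 1.\<close>
  moreover have "\<exists>e\<in>idempotents. \<phi> (star s * (e * s))"
    using \<phi> by (intro bexI[of _ "s * star s"]) (simp_all add: mult.assoc)
  ultimately show ?thesis
    by (auto simp: characters_def)
qed

lemma act_character_mult:
  "sp_act character_sspace (s * t) = sp_act character_sspace s \<circ>\<^sub>m sp_act character_sspace t"
proof
  fix \<phi> :: "'a \<Rightarrow> bool"
  have conj: "star (s * t) * (e * (s * t)) = star t * ((star s * (e * s)) * t)" for e
    by (simp add: star_mult mult.assoc)
  have dom: "star (s * t) * (s * t) = star t * ((star s * s) * t)"
    by (simp add: star_mult mult.assoc)
  show "sp_act character_sspace (s * t) \<phi> =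
      (sp_act character_sspace s \<circ>\<^sub>m sp_act character_sspace t) \<phi>"
  proof (cases "\<phi> \<in> basic_D (star t * t)")
    case True
    define \<psi> where "\<psi> = (\<lambda>e\<in>idempotents. \<phi> (star t * (e * t)))"
    have \<psi>: "\<psi> \<in> characters" "\<And>e. e \<in> idempotents \<Longrightarrow> \<psi> e = \<phi> (star t * (e * t))"
      using translate_in_characters[OF True] by (simp_all add: \<psi>_def)
    have "\<phi> \<in> characters" using True by (simp add: basic_D_def)
    then have "\<phi> \<in> basic_D (star (s * t) * (s * t)) \<longleftrightarrow> \<psi> \<in> basic_D (star s * s)"
      using \<psi>(1) \<psi>(2)[of "star s * s"] by (simp only: basic_D_def dom) simp
    moreover have "(\<lambda>e\<in>idempotents. \<phi> (star (s * t) * (e * (s * t)))) =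
        (\<lambda>e\<in>idempotents. \<psi> (star s * (e * s)))"
      unfolding conj using \<psi>(2) by (intro restrict_ext) simp
    moreover have "sp_act character_sspace t \<phi> = Some \<psi>"
      using True by (simp add: sp_act_character \<psi>_def)
    ultimately show ?thesis
      by (simp add: map_comp_def sp_act_character[of s] sp_act_character[of "s * t"])
  next
    case False
    have "\<phi> \<notin> basic_D (star (s * t) * (s * t))"
    proof
      assume *: "\<phi> \<in> basic_D (star (s * t) * (s * t))"
      \<comment> \<open>The domain idempotent of \<open>s * t\<close> lies below that of
        \<open>t\<close>, so a character with value 1 at the former has value 1 at the
        latter.\<close>
      have "star (s * t) * (s * t) * (star t * t) = star (s * t) * (s * t)"
        by (simp add: mult.assoc)
      then show False
        using * False characters_mult[of \<phi> "star (s * t) * (s * t)" "star t * t"]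
        by (simp add: basic_D_def)
    qed
    then show ?thesis
      using False by (simp add: map_comp_def sp_act_character)
  qed
qed

text \<open>A character with value 1 at \<open>e\<close> takes the same value at \<open>f\<close>
  and at \<open>e * (f * e)\<close>.\<close>

lemma act_character_idempotent:
  assumes e: "e \<in> idempotents" and "sp_act character_sspace e \<phi> = Some \<psi>"
  shows "\<psi> = \<phi>"
proof -
  have \<phi>: "\<phi> \<in> basic_D (star e * e)" and \<psi>: "\<psi> = (\<lambda>f\<in>idempotents. \<phi> (star e * (f * e)))"
    using assms(2) by (auto simp: sp_act_character split: if_splits)
  have "\<psi> \<in> characters"
    using translate_in_characters[OF \<phi>] by (simp add: \<psi>)
  moreover have "\<phi> \<in> characters" "\<phi> e"
    using \<phi> e by (simp_all add: basic_D_def idempotents_iff)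
  ultimately show ?thesis
    using e by (intro characters_eqI) (simp_all add: \<psi> characters_mult)
qed

interpretation character: sspace character_sspace
proof
  fix s :: "'a::inverse_semigroup"
  show dom: "openin (sp_top character_sspace) (sp_dom character_sspace s)"
    by (simp add: sp_dom_character basic_D_clopen)
  have top: "topspace (subtopology character_topology (basic_D (star s * s))) = basic_D (star s * s)"
    by (auto simp: basic_D_def)
  show "continuous_map (subtopology (sp_top character_sspace) (sp_dom character_sspace s))
      (sp_top character_sspace) (sp_app character_sspace s)"
    unfolding sp_top_character sp_dom_character continuous_map_into_characters top
  proof (intro conjI ballI Pi_I)
    show "sp_app character_sspace s \<phi> \<in> characters" if "\<phi> \<in> basic_D (star s * s)" for \<phi>
      using that by (simp add: sp_app_character translate_in_characters)
    fix e :: 'a assume e: "e \<in> idempotents"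
    \<comment> \<open>Each coordinate of the translated character is a coordinate of
      \<open>\<phi>\<close>, namely the one at the conjugated idempotent.\<close>
    have "continuous_map (subtopology character_topology (basic_D (star s * s)))
        (discrete_topology UNIV) (\<lambda>\<phi>. \<phi> (star s * (e * s)))"
      using e by (intro continuous_map_from_subtopology continuous_map_character_eval conjugate_idempotent)
    then show "continuous_map (subtopology character_topology (basic_D (star s * s)))
        (discrete_topology UNIV) (\<lambda>\<phi>. sp_app character_sspace s \<phi> e)"
      by (rule continuous_map_eq) (use e top in \<open>simp add: sp_app_character\<close>)
  qed
next
  fix \<phi> :: "'a::inverse_semigroup \<Rightarrow> bool"
  assume "\<phi> \<in> topspace (sp_top character_sspace)"
  then obtain e where e: "e \<in> idempotents" "\<phi> \<in> basic_D e"
    by (auto simp: characters_def basic_D_def)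
  then have "\<phi> \<in> sp_dom character_sspace e"
    by (simp add: sp_dom_character idempotents_iff)
  then show "\<exists>e\<in>idempotents. \<phi> \<in> sp_dom character_sspace e"
    using e(1) by blast
qed (rule act_character_mult, rule act_character_idempotent)

lemma sp_dom_character_idempotent: "e \<in> idempotents \<Longrightarrow> sp_dom character_sspace e = basic_D e"
  by (simp add: sp_dom_character idempotents_iff)

section \<open>From inverse semigroup spaces to groupoid spaces\<close>

definition sp_anchor :: "('s::inverse_semigroup, 'x) sspace \<Rightarrow> 'x \<Rightarrow> 's \<Rightarrow> bool" where
  "sp_anchor X = (\<lambda>x\<in>topspace (sp_top X). \<lambda>e\<in>idempotents. x \<in> sp_dom X e)"

text \<open>All representatives of a germ act in the same way, so the action may be computed from any one
  of them.\<close>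

definition gspace_of_sspace ::
  "('s::inverse_semigroup, 'x) sspace \<Rightarrow> (('s \<times> ('s \<Rightarrow> bool)) set, 's \<Rightarrow> bool, 'x) gspace" where
  "gspace_of_sspace X =
     \<lparr>gsp_top = sp_top X,
      gsp_anchor = sp_anchor X,
      gsp_act = (\<lambda>(g, x)\<in>{(g, x). g \<in> topspace (gpd_arrows universal_groupoid) \<and>
          x \<in> topspace (sp_top X) \<and> gpd_dom universal_groupoid g = sp_anchor X x}.
        sp_app X (fst (SOME p. p \<in> g)) x)\<rparr>"

lemma gsp_top_gspace_of_sspace [simp]: "gsp_top (gspace_of_sspace X) = sp_top X"
  and gsp_anchor_gspace_of_sspace [simp]: "gsp_anchor (gspace_of_sspace X) = sp_anchor X"
  by (simp_all add: gspace_of_sspace_def)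

lemma topspace_fibre_product [simp]:
  "topspace (fibre_product_topology G X) = fibre_product G X"
  by (auto simp: fibre_product_topology_def fibre_product_def)

lemma universal_arrow_cases:
  assumes "g \<in> topspace (gpd_arrows universal_groupoid)" "gpd_dom universal_groupoid g = \<phi>"
  obtains s where "\<phi> \<in> sp_dom character_sspace s" "g = germ character_sspace s \<phi>"
  using assms
  by (auto simp: universal_groupoid_def character.gpd_dom_germ elim: character.germs_cases)

text \<open>The source of a germ is its base point, so an arrow that can act on \<open>x\<close> is
  a germ based at the anchor of \<open>x\<close>.\<close>

lemma fibre_product_iff:
  "(g, x) \<in> fibre_product universal_groupoid Z \<longleftrightarrow>
     x \<in> topspace (gsp_top Z) \<and>
     (\<exists>s. gsp_anchor Z x \<in> sp_dom character_sspace s \<and> g = germ character_sspace s (gsp_anchor Z x))"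
proof
  assume "(g, x) \<in> fibre_product universal_groupoid Z"
  then show "x \<in> topspace (gsp_top Z) \<and>
     (\<exists>s. gsp_anchor Z x \<in> sp_dom character_sspace s \<and> g = germ character_sspace s (gsp_anchor Z x))"
    by (auto simp: fibre_product_def elim: universal_arrow_cases)
qed (auto simp: fibre_product_def universal_groupoid_def character.gpd_dom_germ)

lemma continuous_map_clopen_indicator:
  assumes "openin T A" "closedin T A"
  shows "continuous_map T (discrete_topology UNIV) (\<lambda>x. x \<in> A)"
proof -
  have "openin T {x \<in> topspace T. (x \<in> A) \<in> U}" for U
  proof -
    have "{x \<in> topspace T. (x \<in> A) \<in> U} =
        (if True \<in> U then A else {}) \<union> (if False \<in> U then topspace T - A else {})"
      using openin_subset[OF assms(1)] by auto (metis (full_types))+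
    then show ?thesis
      using assms by (simp add: closedin_def openin_Un)
  qed
  then show ?thesis
    by (simp add: continuous_map_def)
qed

locale special = sspace X for X :: "('s::inverse_semigroup, 'x) sspace" +
  assumes closed_dom: "e \<in> idempotents \<Longrightarrow> closedin (sp_top X) (sp_dom X e)"

lemma specialI: "special_sspace X \<Longrightarrow> special X"
  by (intro special.intro special_axioms.intro sspaceI) (auto simp: special_sspace_def)

context special
begin

lemma anchor_apply: "x \<in> topspace (sp_top X) \<Longrightarrow> e \<in> idempotents \<Longrightarrow> sp_anchor X x e \<longleftrightarrow> x \<in> sp_dom X e"
  by (simp add: sp_anchor_def)

lemma anchor_character:
  assumes "x \<in> topspace (sp_top X)"
  shows "sp_anchor X x \<in> characters"
proof -
  have "x \<in> sp_dom X (e * f) \<longleftrightarrow> x \<in> sp_dom X e \<and> x \<in> sp_dom X f"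
    if "e \<in> idempotents" "f \<in> idempotents" for e f
    using that by (auto simp: dom_mult_iff app_idempotent)
  then show ?thesis
    using assms cover[OF assms] by (simp add: characters_def sp_anchor_def)
qed

lemma anchor_dom_iff:
  "x \<in> topspace (sp_top X) \<Longrightarrow> sp_anchor X x \<in> sp_dom character_sspace s \<longleftrightarrow> x \<in> sp_dom X s"
  using anchor_apply[of x "star s * s"] by (simp add: sp_dom_character basic_D_def anchor_character)

lemma anchor_germ_eq_iff:
  "x \<in> topspace (sp_top X) \<Longrightarrow> character.germ_eq s t (sp_anchor X x) \<longleftrightarrow> germ_eq s t x"
  by (simp add: character.germ_eq_def germ_eq_def anchor_dom_iff)

text \<open>At \<open>e\<close> both sides ask whether \<open>x\<close> lies in the domain of
  \<open>star s * (e * s)\<close>: the left one by \<open>app_in_dom_iff\<close>, the right one by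
  the definition of the action on characters.\<close>

lemma anchor_app:
  assumes x: "x \<in> sp_dom X s"
  shows "sp_anchor X (sp_app X s x) = sp_app character_sspace s (sp_anchor X x)"
proof (rule characters_eqI)
  have dom: "sp_anchor X x \<in> sp_dom character_sspace s"
    using x by (simp add: anchor_dom_iff dom_topspace)
  show "sp_anchor X (sp_app X s x) \<in> characters"
    using x by (simp add: anchor_character app_topspace)
  show "sp_app character_sspace s (sp_anchor X x) \<in> characters"
    using character.app_topspace[OF dom] by simp
  fix e :: 's assume "e \<in> idempotents"
  then show "sp_anchor X (sp_app X s x) e = sp_app character_sspace s (sp_anchor X x) e"
    using x dom
    by (simp add: anchor_apply app_topspace dom_topspace app_in_dom_iff sp_dom_character sp_app_character)
qed

lemma continuous_map_anchor: "continuous_map (sp_top X) character_topology (sp_anchor X)"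
  unfolding continuous_map_into_characters
proof (intro conjI ballI)
  fix e :: 's assume e: "e \<in> idempotents"
  show "continuous_map (sp_top X) (discrete_topology UNIV) (\<lambda>x. sp_anchor X x e)"
    using continuous_map_clopen_indicator[OF open_dom closed_dom[OF e]]
    by (rule continuous_map_eq) (simp add: anchor_apply e)
qed (simp add: anchor_character)

abbreviation lift :: "'s \<Rightarrow> 'x \<Rightarrow> ('s \<times> ('s \<Rightarrow> bool)) set" where
  "lift s x \<equiv> germ character_sspace s (sp_anchor X x)"

lemma fibre_iff:
  "(g, x) \<in> fibre_product universal_groupoid (gspace_of_sspace X) \<longleftrightarrow> (\<exists>s. x \<in> sp_dom X s \<and> g = lift s x)"
  using dom_topspace by (auto simp: fibre_product_iff anchor_dom_iff)

text \<open>Removes the arbitrary choice from the definition of the action: the chosen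
  representative has the same germ as \<open>s\<close> at the character of \<open>x\<close>, hence
  also at \<open>x\<close>, and a germ determines the image of its base point.\<close>

lemma gsp_act_lift:
  assumes "x \<in> sp_dom X s"
  shows "gsp_act (gspace_of_sspace X) (lift s x, x) = sp_app X s x"
proof -
  define p where "p = (SOME p. p \<in> lift s x)"
  have "(s, sp_anchor X x) \<in> lift s x"
    using assms by (intro character.germ_mem) (simp add: anchor_dom_iff dom_topspace)
  then have "p \<in> lift s x"
    unfolding p_def by (rule someI)
  then have "germ_eq s (fst p) x"
    using assms by (simp add: character.in_germ_iff anchor_germ_eq_iff dom_topspace)
  then have "sp_app X (fst p) x = sp_app X s x"
    by (rule germ_eq_app[symmetric])
  moreover have "(lift s x, x) \<in> fibre_product universal_groupoid (gspace_of_sspace X)"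
    using assms by (auto simp: fibre_iff)
  ultimately show ?thesis
    by (simp add: gspace_of_sspace_def fibre_product_def p_def)
qed

text \<open>Among the germs represented by one fixed \<open>s\<close>, the source determines the
  arrow.\<close>

lemma lift_image_nhd:
  assumes "(g, y) \<in> fibre_product universal_groupoid (gspace_of_sspace X)" "y \<in> sp_dom X s"
    "g \<in> germ character_sspace s ` sp_dom character_sspace s"
  shows "g = lift s y"
  using assms
  by (auto simp: fibre_product_def universal_groupoid_def character.gpd_dom_germ)

text \<open>Near \<open>([s, p(x)], x)\<close> every point of the fibre product has the form \<open>([s, p(y)], y)\<close>.\<close>

lemma openin_fibre_product_nhd:
  assumes U: "openin (sp_top X) U" "U \<subseteq> sp_dom X s"
  shows "openin (fibre_product_topology universal_groupoid (gspace_of_sspace X)) ((\<lambda>y. (lift s y, y)) ` U)"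
proof -
  have "openin (gpd_arrows universal_groupoid) (germ character_sspace s ` sp_dom character_sspace s)"
    unfolding universal_groupoid_def by (intro character.openin_germ_image character.open_dom order_refl)
  then have "openin (prod_topology (gpd_arrows universal_groupoid) (sp_top X))
      ((germ character_sspace s ` sp_dom character_sspace s) \<times> U)"
    using U by (simp add: openin_prod_Times_iff)
  moreover have "(\<lambda>y. (lift s y, y)) ` U =
      ((germ character_sspace s ` sp_dom character_sspace s) \<times> U) \<inter>
      fibre_product universal_groupoid (gspace_of_sspace X)"
  proof -
    have "sp_anchor X y \<in> sp_dom character_sspace s" if "y \<in> U" for y
      using that U dom_topspace by (auto simp: anchor_dom_iff)
    moreover have "(lift s y, y) \<in> fibre_product universal_groupoid (gspace_of_sspace X)" if "y \<in> U" for y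
      using that U(2) by (auto simp: fibre_iff)
    moreover have "g = lift s y" if "(g, y) \<in> fibre_product universal_groupoid (gspace_of_sspace X)"
      "g \<in> germ character_sspace s ` sp_dom character_sspace s" "y \<in> U" for g y
      using lift_image_nhd that U(2) by blast
    ultimately show ?thesis
      by blast
  qed
  ultimately show ?thesis
    by (auto simp: fibre_product_topology_def openin_subtopology)
qed

text \<open>The preimage of \<open>V\<close> is sorted by the element \<open>s\<close> that
  represents the arrow. Each piece lies over the open set of points that \<open>s\<close> sends into
  \<open>V\<close>, and \<open>openin_fibre_product_nhd\<close> makes it open.\<close>

lemma continuous_map_gsp_act:
  "continuous_map (fibre_product_topology universal_groupoid (gspace_of_sspace X)) (sp_top X)
     (gsp_act (gspace_of_sspace X))"
  unfolding continuous_map_def topspace_fibre_product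
proof (intro conjI allI impI Pi_I)
  fix p assume "p \<in> fibre_product universal_groupoid (gspace_of_sspace X)"
  then show "gsp_act (gspace_of_sspace X) p \<in> topspace (sp_top X)"
    by (cases p) (auto simp: fibre_iff gsp_act_lift app_topspace)
next
  fix V assume V: "openin (sp_top X) V"
  have "{p \<in> fibre_product universal_groupoid (gspace_of_sspace X). gsp_act (gspace_of_sspace X) p \<in> V} =
      (\<Union>s. (\<lambda>y. (lift s y, y)) ` {y \<in> sp_dom X s. sp_app X s y \<in> V})"
    (is "?L = ?R")
  proof (intro set_eqI iffI)
    fix p assume p: "p \<in> ?L"
    then obtain s x where "x \<in> sp_dom X s" "p = (lift s x, x)"
      by (cases p) (auto simp: fibre_iff)
    then show "p \<in> ?R"
      using p by (auto simp: gsp_act_lift)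
  qed (auto simp: gsp_act_lift fibre_iff)
  also have "openin (fibre_product_topology universal_groupoid (gspace_of_sspace X)) \<dots>"
    using openin_fibre_product_nhd[OF openin_dom_preimage[OF cont_app V]]
    by (intro openin_Union) blast
  finally show "openin (fibre_product_topology universal_groupoid (gspace_of_sspace X))
      {p \<in> fibre_product universal_groupoid (gspace_of_sspace X). gsp_act (gspace_of_sspace X) p \<in> V}" .
qed

lemma gpd_unit_lift:
  assumes "e \<in> idempotents" "x \<in> sp_dom X e"
  shows "gpd_unit universal_groupoid (sp_anchor X x) = lift e x"
  unfolding universal_groupoid_def
  using assms by (intro character.gpd_unit_germ) (simp_all add: anchor_dom_iff dom_topspace)

lemma gsp_act_unit:
  assumes "x \<in> topspace (sp_top X)"
  shows "gsp_act (gspace_of_sspace X) (gpd_unit universal_groupoid (sp_anchor X x), x) = x"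
proof -
  obtain e where e: "e \<in> idempotents" "x \<in> sp_dom X e"
    using cover assms by blast
  then show ?thesis
    by (simp add: gpd_unit_lift gsp_act_lift app_idempotent)
qed

lemma gpd_ran_lift:
  "x \<in> sp_dom X s \<Longrightarrow> gpd_ran universal_groupoid (lift s x) = sp_anchor X (sp_app X s x)"
  by (simp add: universal_groupoid_def character.gpd_ran_germ anchor_dom_iff dom_topspace anchor_app)

lemma gpd_mult_lift:
  assumes "x \<in> sp_dom X t" "sp_app X t x \<in> sp_dom X s"
  shows "gpd_mult universal_groupoid (lift s (sp_app X t x)) (lift t x) = lift (s * t) x"
proof -
  have "sp_anchor X x \<in> sp_dom character_sspace t"
    "sp_app character_sspace t (sp_anchor X x) \<in> sp_dom character_sspace s"
    using assms by (simp_all add: anchor_dom_iff dom_topspace flip: anchor_app)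
  then show ?thesis
    using assms(1) by (simp add: universal_groupoid_def anchor_app character.gpd_mult_germ)
qed

text \<open>By equivariance of the anchor, an arrow composable with \<open>lift t x\<close> can act
  on \<open>sp_app X t x\<close>. The associative law therefore has to be checked only for lifted
  germs, where it becomes \<open>app_mult\<close>.\<close>

lemma arrow_after_lift:
  assumes "g \<in> topspace (gpd_arrows universal_groupoid)" "x \<in> sp_dom X t"
    "gpd_dom universal_groupoid g = gpd_ran universal_groupoid (lift t x)"
  obtains s where "sp_app X t x \<in> sp_dom X s" "g = lift s (sp_app X t x)"
proof -
  have "(g, sp_app X t x) \<in> fibre_product universal_groupoid (gspace_of_sspace X)"
    using assms by (simp add: fibre_product_def gpd_ran_lift app_topspace)
  then show thesis
    using that by (auto simp: fibre_iff)
qed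

lemma is_gspace_gspace_of_sspace: "is_gspace universal_groupoid (gspace_of_sspace X)"
  unfolding is_gspace_def gsp_top_gspace_of_sspace gsp_anchor_gspace_of_sspace
proof (intro conjI ballI)
  show "sp_anchor X \<in> extensional (topspace (sp_top X))"
    by (simp add: sp_anchor_def)
  show "gsp_act (gspace_of_sspace X) \<in> extensional (fibre_product universal_groupoid (gspace_of_sspace X))"
    by (simp add: gspace_of_sspace_def fibre_product_def)
  show "continuous_map (sp_top X) (gpd_units universal_groupoid) (sp_anchor X)"
    using continuous_map_anchor by (simp add: universal_groupoid_def)
next
  fix p assume "p \<in> fibre_product universal_groupoid (gspace_of_sspace X)"
  then show "case p of (g, x) \<Rightarrow> sp_anchor X (gsp_act (gspace_of_sspace X) (g, x)) = gpd_ran universal_groupoid g"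
    by (auto simp: fibre_iff gsp_act_lift gpd_ran_lift)
next
  fix g :: "('s \<times> ('s \<Rightarrow> bool)) set" and p
  assume g: "g \<in> topspace (gpd_arrows universal_groupoid)"
    and p: "p \<in> fibre_product universal_groupoid (gspace_of_sspace X)"
  obtain t x where t: "x \<in> sp_dom X t" "p = (lift t x, x)"
    using p by (cases p) (auto simp: fibre_iff)
  show "case p of (h, x) \<Rightarrow> gpd_dom universal_groupoid g = gpd_ran universal_groupoid h \<longrightarrow>
      gsp_act (gspace_of_sspace X) (g, gsp_act (gspace_of_sspace X) (h, x)) =
      gsp_act (gspace_of_sspace X) (gpd_mult universal_groupoid g h, x)"
    unfolding t(2) prod.case
  proof
    assume "gpd_dom universal_groupoid g = gpd_ran universal_groupoid (lift t x)"
    then obtain s where "sp_app X t x \<in> sp_dom X s" "g = lift s (sp_app X t x)"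
      using arrow_after_lift g t(1) by blast
    then show "gsp_act (gspace_of_sspace X) (g, gsp_act (gspace_of_sspace X) (lift t x, x)) =
        gsp_act (gspace_of_sspace X) (gpd_mult universal_groupoid g (lift t x), x)"
      using t(1) by (simp add: gsp_act_lift gpd_mult_lift dom_mult_iff app_mult)
  qed
qed (simp_all add: continuous_map_gsp_act gsp_act_unit)

end

section \<open>From groupoid spaces to inverse semigroup spaces\<close>

definition sspace_of_gspace ::
  "(('s \<times> ('s \<Rightarrow> bool)) set, 's \<Rightarrow> bool, 'x) gspace \<Rightarrow> ('s::inverse_semigroup, 'x) sspace" where
  "sspace_of_gspace Z =
     \<lparr>sp_top = gsp_top Z,
      sp_act = (\<lambda>s x. if x \<in> topspace (gsp_top Z) \<and> gsp_anchor Z x \<in> sp_dom character_sspace s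
                    then Some (gsp_act Z (germ character_sspace s (gsp_anchor Z x), x)) else None)\<rparr>"

lemma sp_top_sspace_of_gspace [simp]: "sp_top (sspace_of_gspace Z) = gsp_top Z"
  by (simp add: sspace_of_gspace_def)

lemma sp_dom_sspace_of_gspace:
  "sp_dom (sspace_of_gspace Z) s =
     {x \<in> topspace (gsp_top Z). gsp_anchor Z x \<in> sp_dom character_sspace s}"
  by (auto simp: sspace_of_gspace_def sp_dom_def split: if_splits)

lemma sp_app_sspace_of_gspace:
  "x \<in> sp_dom (sspace_of_gspace Z) s \<Longrightarrow>
     sp_app (sspace_of_gspace Z) s x = gsp_act Z (germ character_sspace s (gsp_anchor Z x), x)"
  by (simp add: sp_dom_sspace_of_gspace) (simp add: sspace_of_gspace_def sp_app_def)

locale universal_gspace =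
  fixes Z :: "(('s::inverse_semigroup \<times> ('s \<Rightarrow> bool)) set, 's \<Rightarrow> bool, 'x) gspace"
  assumes gspace: "is_gspace universal_groupoid Z"
begin

lemma continuous_map_anchor: "continuous_map (gsp_top Z) character_topology (gsp_anchor Z)"
  using gspace by (simp add: is_gspace_def universal_groupoid_def)

lemma anchor_character: "x \<in> topspace (gsp_top Z) \<Longrightarrow> gsp_anchor Z x \<in> characters"
  using continuous_map_funspace[OF continuous_map_anchor] by auto

lemma fibre_dom:
  "x \<in> sp_dom (sspace_of_gspace Z) s \<Longrightarrow>
     (germ character_sspace s (gsp_anchor Z x), x) \<in> fibre_product universal_groupoid Z"
  by (auto simp: fibre_product_iff sp_dom_sspace_of_gspace)

lemma app_in_topspace:
  assumes "x \<in> sp_dom (sspace_of_gspace Z) s"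
  shows "sp_app (sspace_of_gspace Z) s x \<in> topspace (gsp_top Z)"
proof -
  have "gsp_act Z \<in> fibre_product universal_groupoid Z \<rightarrow> topspace (gsp_top Z)"
    using gspace continuous_map_funspace[of "fibre_product_topology universal_groupoid Z" "gsp_top Z" "gsp_act Z"]
    by (simp add: is_gspace_def)
  then show ?thesis
    using fibre_dom[OF assms] assms by (auto simp: sp_app_sspace_of_gspace)
qed

lemma gsp_anchor_app:
  assumes "x \<in> sp_dom (sspace_of_gspace Z) s"
  shows "gsp_anchor Z (sp_app (sspace_of_gspace Z) s x) = sp_app character_sspace s (gsp_anchor Z x)"
proof -
  have "gsp_anchor Z (gsp_act Z (germ character_sspace s (gsp_anchor Z x), x)) =
      gpd_ran universal_groupoid (germ character_sspace s (gsp_anchor Z x))"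
    using gspace fibre_dom[OF assms] unfolding is_gspace_def by blast
  then show ?thesis
    using assms
    by (simp add: sp_app_sspace_of_gspace)
      (simp add: sp_dom_sspace_of_gspace universal_groupoid_def character.gpd_ran_germ)
qed

lemma sp_dom_mult_iff:
  "x \<in> sp_dom (sspace_of_gspace Z) (s * t) \<longleftrightarrow>
     x \<in> sp_dom (sspace_of_gspace Z) t \<and>
     sp_app (sspace_of_gspace Z) t x \<in> sp_dom (sspace_of_gspace Z) s"
  using app_in_topspace[of x t] gsp_anchor_app[of x t]
  by (auto simp: sp_dom_sspace_of_gspace character.dom_mult_iff)

text \<open>This is the law \<open>g (h x) = (g h) x\<close> for \<open>h = [t, p(x)]\<close> and
  \<open>g = [s, p(t x)]\<close>, whose product is \<open>[s * t, p(x)]\<close>. They are composable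
  by \<open>gsp_anchor_app\<close>.\<close>

lemma sp_app_mult:
  assumes "x \<in> sp_dom (sspace_of_gspace Z) (s * t)"
  shows "sp_app (sspace_of_gspace Z) (s * t) x =
    sp_app (sspace_of_gspace Z) s (sp_app (sspace_of_gspace Z) t x)"
proof -
  define \<phi> where "\<phi> = gsp_anchor Z x"
  define y where "y = sp_app (sspace_of_gspace Z) t x"
  have x: "x \<in> sp_dom (sspace_of_gspace Z) t" and y: "y \<in> sp_dom (sspace_of_gspace Z) s"
    using assms unfolding y_def sp_dom_mult_iff by simp_all
  have \<phi>: "\<phi> \<in> sp_dom character_sspace t"
    using x by (simp add: sp_dom_sspace_of_gspace \<phi>_def)
  have \<psi>: "gsp_anchor Z y = sp_app character_sspace t \<phi>"
    using x by (simp add: y_def \<phi>_def gsp_anchor_app)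
  then have dom: "sp_app character_sspace t \<phi> \<in> sp_dom character_sspace s"
    using y by (simp add: sp_dom_sspace_of_gspace)
  have "germ character_sspace s (gsp_anchor Z y) \<in> topspace (gpd_arrows universal_groupoid)"
    using fibre_dom[OF y] by (simp add: fibre_product_def)
  moreover have "gpd_dom universal_groupoid (germ character_sspace s (gsp_anchor Z y)) =
      gpd_ran universal_groupoid (germ character_sspace t (gsp_anchor Z x))"
    using \<phi> dom \<psi>
    by (simp add: universal_groupoid_def character.gpd_dom_germ character.gpd_ran_germ flip: \<phi>_def)
  ultimately have "gsp_act Z (germ character_sspace s (gsp_anchor Z y),
        gsp_act Z (germ character_sspace t (gsp_anchor Z x), x)) =
      gsp_act Z (gpd_mult universal_groupoid (germ character_sspace s (gsp_anchor Z y))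
        (germ character_sspace t (gsp_anchor Z x)), x)"
    using gspace fibre_dom[OF x] unfolding is_gspace_def by blast
  moreover have "gpd_mult universal_groupoid (germ character_sspace s (gsp_anchor Z y))
        (germ character_sspace t (gsp_anchor Z x)) = germ character_sspace (s * t) (gsp_anchor Z x)"
    using \<phi> dom \<psi> by (simp add: universal_groupoid_def character.gpd_mult_germ flip: \<phi>_def)
  moreover have "gsp_act Z (germ character_sspace t (gsp_anchor Z x), x) = y"
    using x by (simp add: y_def sp_app_sspace_of_gspace)
  ultimately show ?thesis
    using sp_app_sspace_of_gspace[OF assms] sp_app_sspace_of_gspace[OF y] by (simp flip: y_def)
qed

lemma sp_act_mult:
  "sp_act (sspace_of_gspace Z) (s * t) = sp_act (sspace_of_gspace Z) s \<circ>\<^sub>m sp_act (sspace_of_gspace Z) t"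
proof
  fix x
  show "sp_act (sspace_of_gspace Z) (s * t) x =
      (sp_act (sspace_of_gspace Z) s \<circ>\<^sub>m sp_act (sspace_of_gspace Z) t) x"
  proof (cases "x \<in> sp_dom (sspace_of_gspace Z) (s * t)")
    case True
    have "sp_act (sspace_of_gspace Z) (s * t) x = Some (sp_app (sspace_of_gspace Z) (s * t) x)"
      "sp_act (sspace_of_gspace Z) t x = Some (sp_app (sspace_of_gspace Z) t x)"
      "sp_act (sspace_of_gspace Z) s (sp_app (sspace_of_gspace Z) t x) =
        Some (sp_app (sspace_of_gspace Z) s (sp_app (sspace_of_gspace Z) t x))"
      using True sp_dom_mult_iff[of x s t] unfolding sp_dom_iff by blast+
    then show ?thesis
      using sp_app_mult[OF True] by (simp add: map_comp_def)
  next
    case False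
    then have "\<not> (x \<in> sp_dom (sspace_of_gspace Z) t \<and>
        sp_app (sspace_of_gspace Z) t x \<in> sp_dom (sspace_of_gspace Z) s)"
      by (simp add: sp_dom_mult_iff)
    with False show ?thesis
      by (auto simp: sp_dom_def sp_app_def map_comp_def domIff split: option.splits)
  qed
qed

text \<open>The germ of an idempotent is a unit of the groupoid, and units act trivially.\<close>

lemma sp_act_idempotent:
  assumes e: "e \<in> idempotents" and y: "sp_act (sspace_of_gspace Z) e x = Some y"
  shows "y = x"
proof -
  have x: "x \<in> sp_dom (sspace_of_gspace Z) e" and "y = sp_app (sspace_of_gspace Z) e x"
    using sp_actD[OF y] by auto
  then have "y = gsp_act Z (germ character_sspace e (gsp_anchor Z x), x)"
    by (simp add: sp_app_sspace_of_gspace)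
  also have "germ character_sspace e (gsp_anchor Z x) = gpd_unit universal_groupoid (gsp_anchor Z x)"
    using x e by (simp add: sp_dom_sspace_of_gspace universal_groupoid_def character.gpd_unit_germ)
  also have "gsp_act Z (\<dots>, x) = x"
    using gspace x unfolding is_gspace_def sp_dom_sspace_of_gspace by blast
  finally show ?thesis .
qed

text \<open>The domain of \<open>s\<close> is the preimage of the clopen set
  \<open>basic_D (star s * s)\<close> under the anchor. The action of \<open>s\<close> is continuous
  because it is \<open>x \<mapsto> ([s, p(x)], x)\<close>, a continuous map into the fibre product,
  followed by the groupoid action.\<close>

sublocale sp: special "sspace_of_gspace Z"
proof
  fix s
  have dom: "sp_dom (sspace_of_gspace Z) s =
      {x \<in> topspace (gsp_top Z). gsp_anchor Z x \<in> basic_D (star s * s)}" for s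
    by (simp add: sp_dom_sspace_of_gspace sp_dom_character)
  show "openin (sp_top (sspace_of_gspace Z)) (sp_dom (sspace_of_gspace Z) s)"
    unfolding dom sp_top_sspace_of_gspace
    by (rule openin_continuous_map_preimage[OF continuous_map_anchor basic_D_clopen(1)]) simp
  show "closedin (sp_top (sspace_of_gspace Z)) (sp_dom (sspace_of_gspace Z) s)"
    unfolding dom sp_top_sspace_of_gspace
    by (rule closedin_continuous_map_preimage[OF continuous_map_anchor basic_D_clopen(2)]) simp
  let ?T = "subtopology (gsp_top Z) (sp_dom (sspace_of_gspace Z) s)"
  have top: "topspace ?T = sp_dom (sspace_of_gspace Z) s"
    by (auto simp: dom)
  have "continuous_map ?T (subtopology character_topology (sp_dom character_sspace s)) (gsp_anchor Z)"
    unfolding continuous_map_in_subtopology top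
    using continuous_map_anchor
    by (auto simp: sp_dom_sspace_of_gspace intro: continuous_map_from_subtopology)
  then have "continuous_map ?T (gpd_arrows universal_groupoid)
      (\<lambda>x. germ character_sspace s (gsp_anchor Z x))"
    using continuous_map_compose[OF _ character.continuous_map_germ]
    by (simp add: universal_groupoid_def o_def)
  moreover have "continuous_map ?T (gsp_top Z) (\<lambda>x. x)"
    by (intro continuous_map_from_subtopology) simp
  ultimately have "continuous_map ?T (fibre_product_topology universal_groupoid Z)
      (\<lambda>x. (germ character_sspace s (gsp_anchor Z x), x))"
    unfolding fibre_product_topology_def continuous_map_in_subtopology top
    using fibre_dom by (simp add: continuous_map_paired)
  moreover have "continuous_map (fibre_product_topology universal_groupoid Z) (gsp_top Z) (gsp_act Z)"
    using gspace by (simp add: is_gspace_def)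
  ultimately have "continuous_map ?T (gsp_top Z)
      (gsp_act Z \<circ> (\<lambda>x. (germ character_sspace s (gsp_anchor Z x), x)))"
    by (rule continuous_map_compose)
  then show "continuous_map (subtopology (sp_top (sspace_of_gspace Z)) (sp_dom (sspace_of_gspace Z) s))
      (sp_top (sspace_of_gspace Z)) (sp_app (sspace_of_gspace Z) s)"
    unfolding sp_top_sspace_of_gspace
    by (rule continuous_map_eq) (unfold top, simp add: sp_app_sspace_of_gspace)
next
  fix x assume "x \<in> topspace (sp_top (sspace_of_gspace Z))"
  then show "\<exists>e\<in>idempotents. x \<in> sp_dom (sspace_of_gspace Z) e"
    using character.cover[of "gsp_anchor Z x"] anchor_character by (auto simp: sp_dom_sspace_of_gspace)
qed (rule sp_act_mult, rule sp_act_idempotent)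

lemma special_sspace_sspace_of_gspace: "special_sspace (sspace_of_gspace Z)"
  unfolding special_sspace_def
  using sp.is_sspaceI[OF sp.open_dom sp.cont_app sp.cover] sp.open_dom sp.closed_dom by blast

lemma sp_anchor_sspace_of_gspace: "sp_anchor (sspace_of_gspace Z) = gsp_anchor Z"
proof (rule extensionalityI[of _ "topspace (gsp_top Z)"])
  show "gsp_anchor Z \<in> extensional (topspace (gsp_top Z))"
    using gspace by (simp add: is_gspace_def)
  fix x assume x: "x \<in> topspace (gsp_top Z)"
  show "sp_anchor (sspace_of_gspace Z) x = gsp_anchor Z x"
  proof (rule characters_eqI)
    show "sp_anchor (sspace_of_gspace Z) x \<in> characters"
      using x by (simp add: sp.anchor_character)
    show "sp_anchor (sspace_of_gspace Z) x e = gsp_anchor Z x e" if "e \<in> idempotents" for e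
      using x that anchor_character[OF x]
      by (simp add: sp.anchor_apply sp_dom_sspace_of_gspace sp_dom_character_idempotent basic_D_def)
  qed (use x anchor_character in auto)
qed (simp add: sp_anchor_def)

text \<open>The anchors agree, hence so do the fibre products; on these the actions are compared
  germ by germ, and outside them both are \<open>undefined\<close>.\<close>

lemma gspace_of_sspace_of_gspace: "gspace_of_sspace (sspace_of_gspace Z) = Z"
proof (rule gspace.equality)
  have fibre: "fibre_product universal_groupoid (gspace_of_sspace (sspace_of_gspace Z)) =
      fibre_product universal_groupoid Z"
    by (simp add: fibre_product_def sp_anchor_sspace_of_gspace)
  show "gsp_act (gspace_of_sspace (sspace_of_gspace Z)) = gsp_act Z"
  proof (rule extensionalityI[of _ "fibre_product universal_groupoid Z"])
    show "gsp_act (gspace_of_sspace (sspace_of_gspace Z)) \<in> extensional (fibre_product universal_groupoid Z)"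
      using sp.is_gspace_gspace_of_sspace by (simp add: is_gspace_def fibre)
    show "gsp_act Z \<in> extensional (fibre_product universal_groupoid Z)"
      using gspace by (simp add: is_gspace_def)
    fix p assume "p \<in> fibre_product universal_groupoid Z"
    then obtain x s where "x \<in> sp_dom (sspace_of_gspace Z) s"
      "p = (germ character_sspace s (sp_anchor (sspace_of_gspace Z) x), x)"
      unfolding fibre[symmetric] by (cases p) (auto simp: sp.fibre_iff)
    then show "gsp_act (gspace_of_sspace (sspace_of_gspace Z)) p = gsp_act Z p"
      by (simp add: sp.gsp_act_lift) (simp add: sp_app_sspace_of_gspace sp_anchor_sspace_of_gspace)
  qed
qed (simp_all add: sp_anchor_sspace_of_gspace)

end

context special
begin

text \<open>Partial maps carry their domains with them, so \<open>anchor_dom_iff\<close> settles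
  where the two are \<open>None\<close>, and \<open>gsp_act_lift\<close> settles their values
  elsewhere.\<close>

lemma sspace_of_gspace_of_sspace: "sspace_of_gspace (gspace_of_sspace X) = X"
proof (rule sspace.equality)
  show "sp_act (sspace_of_gspace (gspace_of_sspace X)) = sp_act X"
  proof (intro ext)
    fix s x
    show "sp_act (sspace_of_gspace (gspace_of_sspace X)) s x = sp_act X s x"
    proof (cases "x \<in> sp_dom X s")
      case True
      then have "sp_act X s x = Some (sp_app X s x)"
        by (simp only: sp_dom_iff)
      then show ?thesis
        using True by (simp add: sspace_of_gspace_def anchor_dom_iff dom_topspace gsp_act_lift)
    next
      case False
      then have "sp_act X s x = None"
        by (simp add: sp_dom_def domIff)
      then show ?thesis
        using False by (simp add: sspace_of_gspace_def anchor_dom_iff)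
    qed
  qed
qed simp_all

end

section \<open>Morphisms\<close>

text \<open>Literal equality of these sets is what lets both functors leave maps unchanged.\<close>

lemma sspace_hom_eq_gspace_hom:
  assumes "special X" "special Y"
  shows "sspace_hom X Y = gspace_hom universal_groupoid (gspace_of_sspace X) (gspace_of_sspace Y)"
proof -
  interpret X: special X by fact
  interpret Y: special Y by fact
  \<comment> \<open>A character is determined by the idempotents at which it is 1, so the preimage
    condition for all \<open>e\<close> amounts to preservation of the anchor.\<close>
  have dom_iff_anchor:
    "(\<forall>e\<in>idempotents. {x \<in> topspace (sp_top X). f x \<in> sp_dom Y e} = sp_dom X e) \<longleftrightarrow>
     (\<forall>x\<in>topspace (sp_top X). sp_anchor Y (f x) = sp_anchor X x)" (is "?dom \<longleftrightarrow> ?anchor")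
    if f: "f \<in> topspace (sp_top X) \<rightarrow> topspace (sp_top Y)" for f
  proof -
    have "sp_anchor Y (f x) = sp_anchor X x \<longleftrightarrow> (\<forall>e\<in>idempotents. f x \<in> sp_dom Y e \<longleftrightarrow> x \<in> sp_dom X e)"
      if x: "x \<in> topspace (sp_top X)" for x
    proof -
      have fx: "f x \<in> topspace (sp_top Y)"
        using f x by blast
      have "sp_anchor Y (f x) = sp_anchor X x \<longleftrightarrow>
          (\<forall>e\<in>idempotents. sp_anchor Y (f x) e = sp_anchor X x e)"
        using characters_eqI X.anchor_character[OF x] Y.anchor_character[OF fx] by metis
      then show ?thesis
        using x fx by (simp add: X.anchor_apply Y.anchor_apply)
    qed
    moreover have "?dom \<longleftrightarrow>
        (\<forall>x\<in>topspace (sp_top X). \<forall>e\<in>idempotents. f x \<in> sp_dom Y e \<longleftrightarrow> x \<in> sp_dom X e)"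
      using X.dom_topspace by blast
    ultimately show ?thesis by simp
  qed
  \<comment> \<open>Once anchors are preserved, the germ of \<open>s\<close> lifted at
    \<open>x\<close> is also the one lifted at \<open>f x\<close>, so both conditions compare the
    same points for every \<open>s\<close>.\<close>
  have equivariant_iff:
    "(\<forall>s. \<forall>x\<in>sp_dom X (star s * s). f (sp_app X s x) = sp_app Y s (f x)) \<longleftrightarrow>
     (\<forall>(g, x)\<in>fibre_product universal_groupoid (gspace_of_sspace X).
        f (gsp_act (gspace_of_sspace X) (g, x)) = gsp_act (gspace_of_sspace Y) (g, f x))"
    (is "_ \<longleftrightarrow> ?R")
    if f: "f \<in> topspace (sp_top X) \<rightarrow> topspace (sp_top Y)"
      and anchor: "\<forall>x\<in>topspace (sp_top X). sp_anchor Y (f x) = sp_anchor X x" for f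
  proof -
    have "gsp_act (gspace_of_sspace Y) (X.lift s x, f x) = sp_app Y s (f x)" if x: "x \<in> sp_dom X s" for s x
    proof -
      have "sp_anchor Y (f x) = sp_anchor X x" "f x \<in> topspace (sp_top Y)"
        using f anchor X.dom_topspace[OF x] by auto
      moreover from this have "f x \<in> sp_dom Y s"
        using x X.dom_topspace[OF x] by (simp add: X.anchor_dom_iff flip: Y.anchor_dom_iff)
      ultimately show ?thesis
        using Y.gsp_act_lift[of "f x" s] by simp
    qed
    moreover have "?R \<longleftrightarrow> (\<forall>s. \<forall>x\<in>sp_dom X s.
        f (gsp_act (gspace_of_sspace X) (X.lift s x, x)) = gsp_act (gspace_of_sspace Y) (X.lift s x, f x))"
    proof (intro iffI allI ballI)
      fix s x assume R: ?R and "x \<in> sp_dom X s"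
      then have "(X.lift s x, x) \<in> fibre_product universal_groupoid (gspace_of_sspace X)"
        by (auto simp: X.fibre_iff)
      from bspec[OF R this]
      show "f (gsp_act (gspace_of_sspace X) (X.lift s x, x)) = gsp_act (gspace_of_sspace Y) (X.lift s x, f x)"
        by simp
    qed (auto simp: X.fibre_iff)
    ultimately show ?thesis
      by (simp add: X.gsp_act_lift)
  qed
  show ?thesis
  proof (intro set_eqI)
    fix f
    show "f \<in> sspace_hom X Y \<longleftrightarrow>
        f \<in> gspace_hom universal_groupoid (gspace_of_sspace X) (gspace_of_sspace Y)"
    proof (cases "continuous_map (sp_top X) (sp_top Y) f")
      case True
      then have "f \<in> topspace (sp_top X) \<rightarrow> topspace (sp_top Y)"
        by (rule continuous_map_funspace)
      note eqs = dom_iff_anchor[OF this] equivariant_iff[OF this]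
      show ?thesis
        unfolding sspace_hom_def gspace_hom_def mem_Collect_eq eqs(1)
          gsp_top_gspace_of_sspace gsp_anchor_gspace_of_sspace
        using eqs(2) by blast
    qed (simp add: sspace_hom_def gspace_hom_def)
  qed
qed

text \<open>For extensional maps between carriers the unit and associative laws are identities of
  functions; only the closure of morphisms under identities and composition depends on the
  structure.\<close>

lemma is_category_concrete:
  assumes "\<And>X. X \<in> Ob \<Longrightarrow> restrict id (T X) \<in> H X X"
    and hom: "\<And>X Y f. X \<in> Ob \<Longrightarrow> Y \<in> Ob \<Longrightarrow> f \<in> H X Y \<Longrightarrow> f \<in> T X \<rightarrow>\<^sub>E T Y"
    and "\<And>X Y Z f g. X \<in> Ob \<Longrightarrow> Y \<in> Ob \<Longrightarrow> Z \<in> Ob \<Longrightarrow> f \<in> H X Y \<Longrightarrow> g \<in> H Y Z \<Longrightarrow>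
      compose (T X) g f \<in> H X Z"
  shows "is_category \<lparr>cat_ob = Ob, cat_hom = H, cat_id = (\<lambda>X. restrict id (T X)),
    cat_comp = (\<lambda>X Y Z g f. compose (T X) g f)\<rparr>"
proof -
  have "compose (T X) f (restrict id (T X)) = f" "compose (T X) (restrict id (T Y)) f = f"
    if "X \<in> Ob" "Y \<in> Ob" "f \<in> H X Y" for X Y f
    using hom[OF that] by (auto simp: compose_def fun_eq_iff PiE_def extensional_def)
  moreover have "compose (T W) (compose (T X) h g) f = compose (T W) h (compose (T W) g f)"
    if "W \<in> Ob" "X \<in> Ob" "f \<in> H W X" for W X h g f
    using hom[OF that] by (auto simp: compose_def fun_eq_iff PiE_def)
  ultimately show ?thesis
    unfolding is_category_def category.simps using assms(1,3) by (intro conjI ballI)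
qed

lemma is_category_gspace_category:
  fixes G :: "('g, 'b) groupoid"
  shows "is_category (gspace_category G :: (('g, 'b, 'x) gspace, 'x \<Rightarrow> 'x) category)"
  unfolding gspace_category_def
proof (rule is_category_concrete)
  fix X :: "('g, 'b, 'x) gspace"
  show "restrict id (topspace (gsp_top X)) \<in> gspace_hom G X X"
    if "X \<in> {X. is_gspace G X}"
  proof -
    have "gsp_act X (g, x) \<in> topspace (gsp_top X)" if "(g, x) \<in> fibre_product G X" for g x
      using \<open>X \<in> _\<close> that continuous_map_funspace[of "fibre_product_topology G X" "gsp_top X" "gsp_act X"]
      by (auto simp: is_gspace_def)
    moreover have "continuous_map (gsp_top X) (gsp_top X) (restrict id (topspace (gsp_top X)))"
      by (rule continuous_map_eq[of _ _ id]) auto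
    ultimately show ?thesis
      by (auto simp: gspace_hom_def fibre_product_def)
  qed
next
  fix X Y :: "('g, 'b, 'x) gspace" and f
  assume "f \<in> gspace_hom G X Y"
  then show "f \<in> topspace (gsp_top X) \<rightarrow>\<^sub>E topspace (gsp_top Y)"
    using continuous_map_funspace[of "gsp_top X" "gsp_top Y" f] by (auto simp: gspace_hom_def PiE_def)
next
  fix X Y Z :: "('g, 'b, 'x) gspace" and f g
  assume X: "X \<in> {X. is_gspace G X}" and f: "f \<in> gspace_hom G X Y" and g: "g \<in> gspace_hom G Y Z"
  have act: "gsp_act X (h, x) \<in> topspace (gsp_top X)" if "(h, x) \<in> fibre_product G X" for h x
    using X that continuous_map_funspace[of "fibre_product_topology G X" "gsp_top X" "gsp_act X"]
    by (auto simp: is_gspace_def)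
  have fX: "f x \<in> topspace (gsp_top Y)" if "x \<in> topspace (gsp_top X)" for x
    using f that continuous_map_funspace[of "gsp_top X" "gsp_top Y" f] by (auto simp: gspace_hom_def)
  have "continuous_map (gsp_top X) (gsp_top Z) (compose (topspace (gsp_top X)) g f)"
    by (rule continuous_map_eq[of _ _ "g \<circ> f"])
      (use f g in \<open>auto simp: gspace_hom_def compose_def intro: continuous_map_compose\<close>)
  moreover have "compose (topspace (gsp_top X)) g f (gsp_act X (h, x)) =
      gsp_act Z (h, compose (topspace (gsp_top X)) g f x)" if hx: "(h, x) \<in> fibre_product G X" for h x
  proof -
    have x: "x \<in> topspace (gsp_top X)"
      using hx by (simp add: fibre_product_def)
    have "(h, f x) \<in> fibre_product G Y"
      using hx f fX by (auto simp: fibre_product_def gspace_hom_def)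
    then have "g (gsp_act Y (h, f x)) = gsp_act Z (h, g (f x))"
      using g by (auto simp: gspace_hom_def)
    moreover have "f (gsp_act X (h, x)) = gsp_act Y (h, f x)"
      using f hx by (auto simp: gspace_hom_def)
    ultimately show ?thesis
      using x act[OF hx] by (simp add: compose_def)
  qed
  moreover have "gsp_anchor Z (compose (topspace (gsp_top X)) g f x) = gsp_anchor X x"
    if "x \<in> topspace (gsp_top X)" for x
    using f g fX that by (simp add: gspace_hom_def compose_def)
  ultimately show "compose (topspace (gsp_top X)) g f \<in> gspace_hom G X Z"
    by (auto simp: gspace_hom_def compose_extensional)
qed

text \<open>Inherited from groupoid spaces: \<open>gspace_of_sspace\<close> keeps carriers and
  hom-sets literally, so identities and composites are the same functions on both sides.\<close>

lemma is_category_special_sspace_category: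
  "is_category (special_sspace_category :: (('s::inverse_semigroup, 'x) sspace, 'x \<Rightarrow> 'x) category)"
proof -
  let ?C = "gspace_category universal_groupoid ::
    ((('s \<times> ('s \<Rightarrow> bool)) set, 's \<Rightarrow> bool, 'x) gspace, 'x \<Rightarrow> 'x) category"
  have cat: "is_category ?C"
    by (rule is_category_gspace_category)
  have ob: "gspace_of_sspace X \<in> cat_ob ?C" if "special_sspace X" for X
    using special.is_gspace_gspace_of_sspace[OF specialI[OF that]] by (simp add: gspace_category_def)
  have hom: "sspace_hom X Y = cat_hom ?C (gspace_of_sspace X) (gspace_of_sspace Y)"
    if "special_sspace X" "special_sspace Y" for X Y
    unfolding gspace_category_def category.simps
    using that by (intro sspace_hom_eq_gspace_hom specialI)
  show ?thesis
    unfolding special_sspace_category_def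
  proof (rule is_category_concrete)
    fix X :: "('s, 'x) sspace"
    assume X: "X \<in> {X. special_sspace X}"
    then have "cat_id ?C (gspace_of_sspace X) \<in> cat_hom ?C (gspace_of_sspace X) (gspace_of_sspace X)"
      using cat ob[of X] unfolding is_category_def by blast
    then show "restrict id (topspace (sp_top X)) \<in> sspace_hom X X"
      using X by (simp add: hom) (simp add: gspace_category_def)
  next
    fix X Y :: "('s, 'x) sspace" and f
    assume "f \<in> sspace_hom X Y"
    then show "f \<in> topspace (sp_top X) \<rightarrow>\<^sub>E topspace (sp_top Y)"
      using continuous_map_funspace[of "sp_top X" "sp_top Y" f] by (auto simp: sspace_hom_def PiE_def)
  next
    fix X Y Z :: "('s, 'x) sspace" and f g
    assume XYZ: "X \<in> {X. special_sspace X}" "Y \<in> {X. special_sspace X}" "Z \<in> {X. special_sspace X}"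
      and "f \<in> sspace_hom X Y" "g \<in> sspace_hom Y Z"
    then have "cat_comp ?C (gspace_of_sspace X) (gspace_of_sspace Y) (gspace_of_sspace Z) g f
        \<in> cat_hom ?C (gspace_of_sspace X) (gspace_of_sspace Z)"
      using cat[unfolded is_category_def] ob by (simp add: hom)
    then show "compose (topspace (sp_top X)) g f \<in> sspace_hom X Z"
      using XYZ by (simp add: hom) (simp add: gspace_category_def)
  qed
qed

section \<open>Germs and the semidirect product\<close>

text \<open>The union over representatives follows the style of \<open>germ_groupoid\<close>; that
  all its members are one and the same class is the content of
  \<open>germ_comparison_germ\<close>.\<close>

definition germ_comparison ::
  "('s::inverse_semigroup, 'x) sspace \<Rightarrow> ('s \<times> 'x) set \<Rightarrow> ('s \<times> ('s \<Rightarrow> bool)) set \<times> 'x" where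
  "germ_comparison X g =
     (\<Union>(s, x)\<in>g. germ character_sspace s (sp_anchor X x), gpd_dom (germ_groupoid X) g)"

context special
begin

lemma germ_comparison_germ:
  assumes "x \<in> sp_dom X s"
  shows "germ_comparison X (germ X s x) = (lift s x, x)"
proof -
  have "(\<Union>(t, y)\<in>germ X s x. lift t y) = lift s x"
    using assms
    by (rule UN_germ)
      (use assms in \<open>auto simp: anchor_germ_eq_iff dom_topspace germ_eq_sym intro!: character.germ_eqI\<close>)
  then show ?thesis
    using assms by (simp add: germ_comparison_def gpd_dom_germ)
qed

text \<open>Injectivity is the passage of germ equality from characters back to points. Continuity
  is tested along each \<open>germ X s\<close>; openness reduces by \<open>openin_germ_nhd\<close>
  to basic sets, whose images are open by \<open>openin_fibre_product_nhd\<close>.\<close>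

lemma homeomorphic_map_germ_comparison:
  "homeomorphic_map (gpd_arrows (germ_groupoid X))
     (fibre_product_topology universal_groupoid (gspace_of_sspace X)) (germ_comparison X)"
proof (rule bijective_open_imp_homeomorphic_map)
  show "germ_comparison X ` topspace (gpd_arrows (germ_groupoid X)) =
      topspace (fibre_product_topology universal_groupoid (gspace_of_sspace X))"
    by (force simp: fibre_iff germ_comparison_germ germs_def)
  show "inj_on (germ_comparison X) (topspace (gpd_arrows (germ_groupoid X)))"
  proof (rule inj_onI)
    fix g h assume "g \<in> topspace (gpd_arrows (germ_groupoid X))"
      "h \<in> topspace (gpd_arrows (germ_groupoid X))" and eq: "germ_comparison X g = germ_comparison X h"
    then obtain s x t y where gh: "x \<in> sp_dom X s" "g = germ X s x" "y \<in> sp_dom X t" "h = germ X t y"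
      by (auto elim!: germs_cases)
    then have "x = y" "lift s x = lift t x"
      using eq by (auto simp: germ_comparison_germ)
    then have "germ_eq s t x"
      using gh(1) by (simp add: character.germ_eq_iff anchor_dom_iff dom_topspace anchor_germ_eq_iff)
    then show "g = h"
      using gh \<open>x = y\<close> germ_eqI by simp
  qed
  show "continuous_map (gpd_arrows (germ_groupoid X))
      (fibre_product_topology universal_groupoid (gspace_of_sspace X)) (germ_comparison X)"
  proof (rule continuous_map_from_germ)
    fix s
    let ?T = "subtopology (sp_top X) (sp_dom X s)"
    have "continuous_map ?T (subtopology character_topology (sp_dom character_sspace s)) (sp_anchor X)"
      unfolding continuous_map_in_subtopology topspace_dom
      using continuous_map_anchor
      by (auto simp: anchor_dom_iff dom_topspace intro: continuous_map_from_subtopology)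
    then have "continuous_map ?T (gpd_arrows universal_groupoid) (lift s)"
      using continuous_map_compose[OF _ character.continuous_map_germ]
      by (simp add: universal_groupoid_def o_def)
    moreover have "continuous_map ?T (sp_top X) (\<lambda>x. x)"
      by (intro continuous_map_from_subtopology) simp
    ultimately have "continuous_map ?T (fibre_product_topology universal_groupoid (gspace_of_sspace X))
        (\<lambda>x. (lift s x, x))"
      unfolding fibre_product_topology_def continuous_map_in_subtopology topspace_dom
      by (auto simp: continuous_map_paired fibre_iff)
    then show "continuous_map ?T (fibre_product_topology universal_groupoid (gspace_of_sspace X))
        (\<lambda>x. germ_comparison X (germ X s x))"
      by (rule continuous_map_eq) (unfold topspace_dom, simp add: germ_comparison_germ)
  qed
  show "open_map (gpd_arrows (germ_groupoid X))
      (fibre_product_topology universal_groupoid (gspace_of_sspace X)) (germ_comparison X)"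
    unfolding open_map_def
  proof (intro allI impI)
    fix W assume W: "openin (gpd_arrows (germ_groupoid X)) W"
    show "openin (fibre_product_topology universal_groupoid (gspace_of_sspace X)) (germ_comparison X ` W)"
    proof (subst openin_subopen, intro ballI)
      fix p assume "p \<in> germ_comparison X ` W"
      then obtain g where "p = germ_comparison X g" "g \<in> W"
        by blast
      moreover have "g \<in> germs"
        using \<open>g \<in> W\<close> openin_subset[OF W] by auto
      then obtain s x where x: "x \<in> sp_dom X s" "g = germ X s x"
        by (rule germs_cases)
      ultimately obtain U where U: "openin (sp_top X) U" "x \<in> U" "U \<subseteq> sp_dom X s" "germ X s ` U \<subseteq> W"
        using openin_germ_nhd[OF W] by blast
      have "(\<lambda>y. (lift s y, y)) ` U = germ_comparison X ` germ X s ` U"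
        unfolding image_image using U(3) germ_comparison_germ by (intro image_cong) auto
      then have "p \<in> (\<lambda>y. (lift s y, y)) ` U"
        "(\<lambda>y. (lift s y, y)) ` U \<subseteq> germ_comparison X ` W"
        using U x(2) \<open>p = _\<close> by blast+
      then show "\<exists>T. openin (fibre_product_topology universal_groupoid (gspace_of_sspace X)) T \<and>
          p \<in> T \<and> T \<subseteq> germ_comparison X ` W"
        using openin_fibre_product_nhd[OF U(1,3)] by blast
    qed
  qed
qed

lemma gpd_inv_lift:
  "x \<in> sp_dom X s \<Longrightarrow> gpd_inv universal_groupoid (lift s x) = lift (star s) (sp_app X s x)"
  by (simp add: universal_groupoid_def character.gpd_inv_germ anchor_dom_iff dom_topspace anchor_app)

lemma topological_groupoid_iso_germ_comparison:
  "topological_groupoid_iso (germ_groupoid X)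
     (semidirect_product universal_groupoid (gspace_of_sspace X)) (germ_comparison X) id"
  unfolding topological_groupoid_iso_def
proof (intro conjI ballI impI)
  show "homeomorphic_map (gpd_arrows (germ_groupoid X))
      (gpd_arrows (semidirect_product universal_groupoid (gspace_of_sspace X))) (germ_comparison X)"
    using homeomorphic_map_germ_comparison by (simp add: semidirect_product_def)
  show "homeomorphic_map (gpd_units (germ_groupoid X))
      (gpd_units (semidirect_product universal_groupoid (gspace_of_sspace X))) id"
    by (simp add: semidirect_product_def)
next
  fix x assume "x \<in> topspace (gpd_units (germ_groupoid X))"
  then obtain e where "e \<in> idempotents" "x \<in> sp_dom X e"
    using cover[of x] by auto
  then show "germ_comparison X (gpd_unit (germ_groupoid X) x) =
      gpd_unit (semidirect_product universal_groupoid (gspace_of_sspace X)) (id x)"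
    by (simp add: gpd_unit_germ germ_comparison_germ semidirect_product_def gpd_unit_lift)
next
  fix g assume "g \<in> topspace (gpd_arrows (germ_groupoid X))"
  then obtain s x where x: "x \<in> sp_dom X s" "g = germ X s x"
    by (auto elim: germs_cases)
  show "gpd_dom (semidirect_product universal_groupoid (gspace_of_sspace X)) (germ_comparison X g) =
      id (gpd_dom (germ_groupoid X) g)"
    "gpd_ran (semidirect_product universal_groupoid (gspace_of_sspace X)) (germ_comparison X g) =
      id (gpd_ran (germ_groupoid X) g)"
    "germ_comparison X (gpd_inv (germ_groupoid X) g) =
      gpd_inv (semidirect_product universal_groupoid (gspace_of_sspace X)) (germ_comparison X g)"
    using x by (simp_all add: semidirect_product_def germ_comparison_germ gpd_dom_germ gpd_ran_germ
        gsp_act_lift gpd_inv_germ app_in_dom_star gpd_inv_lift)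
next
  fix g h assume "g \<in> topspace (gpd_arrows (germ_groupoid X))"
    "h \<in> topspace (gpd_arrows (germ_groupoid X))"
    and gh: "gpd_dom (germ_groupoid X) g = gpd_ran (germ_groupoid X) h"
  then obtain s z t y where z: "z \<in> sp_dom X s" "g = germ X s z" and y: "y \<in> sp_dom X t" "h = germ X t y"
    by (auto elim!: germs_cases)
  \<comment> \<open>Composability brings the first factor into the form \<open>[s, t y]\<close>, for
    which products of germs are computed.\<close>
  then have "z = sp_app X t y"
    using gh by (simp add: gpd_dom_germ gpd_ran_germ)
  then show "germ_comparison X (gpd_mult (germ_groupoid X) g h) =
      gpd_mult (semidirect_product universal_groupoid (gspace_of_sspace X))
        (germ_comparison X g) (germ_comparison X h)"
    using z y
    by (simp add: gpd_mult_germ germ_comparison_germ dom_mult_iff semidirect_product_def gpd_mult_lift)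
qed

end

theorem theorem6p4:
  shows "\<exists>(F :: (('s::{inverse_semigroup,countable}, 'x) sspace, 'x \<Rightarrow> 'x,
                (('s \<times> ('s \<Rightarrow> bool)) set, 's \<Rightarrow> bool, 'x) gspace, 'x \<Rightarrow> 'x) cat_functor) G.
     category_isomorphism special_sspace_category (gspace_category universal_groupoid) F G \<and>
     (\<forall>X. special_sspace X \<longrightarrow> gsp_top (fun_ob F X) = sp_top X) \<and>
     (\<forall>X Y. special_sspace X \<longrightarrow> special_sspace Y \<longrightarrow>
        (\<forall>f\<in>sspace_hom X Y. fun_hom F X Y f = f)) \<and>
     (\<forall>Z. is_gspace universal_groupoid Z \<longrightarrow> sp_top (fun_ob G Z) = gsp_top Z) \<and>
     (\<forall>Z W. is_gspace universal_groupoid Z \<longrightarrow> is_gspace universal_groupoid W \<longrightarrow>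
        (\<forall>f\<in>gspace_hom universal_groupoid Z W. fun_hom G Z W f = f)) \<and>
     (\<forall>X. special_sspace X \<longrightarrow>
        topologically_isomorphic (germ_groupoid X)
          (semidirect_product universal_groupoid (fun_ob F X)))"
proof -
  let ?F = "\<lparr>fun_ob = gspace_of_sspace, fun_hom = \<lambda>X Y f. f\<rparr> ::
    (('s, 'x) sspace, 'x \<Rightarrow> 'x, (('s \<times> ('s \<Rightarrow> bool)) set, 's \<Rightarrow> bool, 'x) gspace, 'x \<Rightarrow> 'x) cat_functor"
  let ?G = "\<lparr>fun_ob = sspace_of_gspace, fun_hom = \<lambda>Z W f. f\<rparr> ::
    ((('s \<times> ('s \<Rightarrow> bool)) set, 's \<Rightarrow> bool, 'x) gspace, 'x \<Rightarrow> 'x, ('s, 'x) sspace, 'x \<Rightarrow> 'x) cat_functor"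
  have F: "is_gspace universal_groupoid (gspace_of_sspace X)" "sspace_of_gspace (gspace_of_sspace X) = X"
    if "special_sspace X" for X :: "('s, 'x) sspace"
    using specialI[OF that] special.is_gspace_gspace_of_sspace special.sspace_of_gspace_of_sspace by blast+
  have G: "special_sspace (sspace_of_gspace Z)" "gspace_of_sspace (sspace_of_gspace Z) = Z"
    if "is_gspace universal_groupoid Z" for Z :: "(('s \<times> ('s \<Rightarrow> bool)) set, 's \<Rightarrow> bool, 'x) gspace"
    using that universal_gspace.special_sspace_sspace_of_gspace
      universal_gspace.gspace_of_sspace_of_gspace universal_gspace.intro by blast+
  have hom: "sspace_hom X Y = gspace_hom universal_groupoid (gspace_of_sspace X) (gspace_of_sspace Y)"
    if "special_sspace X" "special_sspace Y" for X Y :: "('s, 'x) sspace"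
    using that by (intro sspace_hom_eq_gspace_hom specialI)
  \<comment> \<open>This is \<open>hom\<close> at the objects coming from \<open>Z\<close> and
    \<open>W\<close>, combined with the round trip on objects.\<close>
  have hom': "gspace_hom universal_groupoid Z W = sspace_hom (sspace_of_gspace Z) (sspace_of_gspace W)"
    if "is_gspace universal_groupoid Z" "is_gspace universal_groupoid W"
    for Z W :: "(('s \<times> ('s \<Rightarrow> bool)) set, 's \<Rightarrow> bool, 'x) gspace"
    using that by (simp add: hom G)
  have C: "is_category (special_sspace_category :: (('s, 'x) sspace, 'x \<Rightarrow> 'x) category)"
    by (rule is_category_special_sspace_category)
  have D: "is_category (gspace_category universal_groupoid ::
      ((('s \<times> ('s \<Rightarrow> bool)) set, 's \<Rightarrow> bool, 'x) gspace, 'x \<Rightarrow> 'x) category)"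
    by (rule is_category_gspace_category)
  have "is_functor special_sspace_category (gspace_category universal_groupoid) ?F"
    unfolding is_functor_def using C D
    by (simp add: special_sspace_category_def gspace_category_def F(1) hom)
  moreover have "is_functor (gspace_category universal_groupoid) special_sspace_category ?G"
    unfolding is_functor_def using C D
    by (simp add: special_sspace_category_def gspace_category_def G(1) hom')
  moreover have "left_inverse_functor special_sspace_category ?F ?G"
    by (simp add: left_inverse_functor_def special_sspace_category_def F(2))
  moreover have "left_inverse_functor (gspace_category universal_groupoid) ?G ?F"
    by (simp add: left_inverse_functor_def gspace_category_def G(2))
  ultimately have "category_isomorphism special_sspace_category (gspace_category universal_groupoid) ?F ?G"
    by (simp add: category_isomorphism_def)
  moreover have "topologically_isomorphic (germ_groupoid X)
      (semidirect_product universal_groupoid (gspace_of_sspace X))"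
    if "special_sspace X" for X :: "('s, 'x) sspace"
    using special.topological_groupoid_iso_germ_comparison[OF specialI[OF that]]
    unfolding topologically_isomorphic_def by blast
  ultimately show ?thesis
    by (intro exI[of _ ?F] exI[of _ ?G]) simp
qed

end
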